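(* Let $s\ge1$. In local coordinates, write a general element of $\mathrm{Gr}^1\Omega^{n,s}$ as $$\eta_A=A^i_{\alpha_1\cdots\alpha_{s-1}\alpha_s}\,\theta^{\alpha_1}\wedge\cdots\wedge\theta^{\alpha_{s-1}}\wedge\theta^{\alpha_s}_i\wedge\nu$$ (summation over repeated indices), where the coefficients $A^i_{\alpha_1\cdots\alpha_{s-1}\alpha_s}\in\mathcal R^\infty$ are totally antisymmetric in $\alpha_1,\dots,\alpha_{s-1}$. Then the map $\bar I_1$ induced by the interior Euler operator on $\mathrm{Gr}^1\Omega^{n,s}$ satisfies $$\mathrm{im}(\bar I_1)=\Big\{\eta_A:\ \sum_{k=0}^{s-1}(-1)^{(s-1)k}A^i_{\alpha_{k+1}\cdots\alpha_s\alpha_1\cdots\alpha_{k-1}\alpha_k}=0\Big\},$$ $$\ker(\bar I_1)=\Big\{\eta_A:\ sA^i_{\alpha_1\cdots\alpha_{s-1}\alpha_s}=\sum_{k=0}^{s-1}(-1)^{(s-1)k}A^i_{\alpha_{k+1}\cdots\alpha_s\alpha_1\cdots\alpha_{k-1}\alpha_k}\Big\},$$ the conditions being required for all $i,\alpha_1,\dots,\alpha_s$. Here the lower indices in the $k$-th summand are the cyclic permutation $(\alpha_{k+1},\dots,\alpha_s,\alpha_1,\dots,\alpha_k)$ of $(\alpha_1,\dots,\alpha_s)$ (the identity for $k=0$).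
   Context: Let $\pi\colon E\to M$ be a smooth fibre bundle with finite-dimensional fibres over an $n$-dimensional manifold $M$ with a chosen volume form $\nu$. Let $x^i$ ($1\le i\le n$) be local coordinates on $M$ and $u^\alpha$ local fibre coordinates on $E$; the claim is about expressions over such a coordinate chart. The $k$-jet space $J^kE$ has fibre coordinates $u^\alpha_I$, $0\le|I|\le k$, over $M$, where $I$ is an unordered (symmetric) multi-index with entries in $\{1,\dots,n\}$ and $|I|$ is its length; $Ij$ denotes $I$ with $j$ appended. $J^\infty E$ is the inverse limit of the $J^kE$. Smooth functions and forms on $J^\infty E$ are those of finite order: $\mathcal R^\infty=\bigcup_{k\ge0}C^\infty(J^kE)$ and $\Omega^p(J^\infty E)=\bigcup_{k\ge0}\Omega^p(J^kE)$ (identified via pull-back). Contact forms are $\theta^\alpha_I=du^\alpha_I-u^\alpha_{Ij}dx^j$ (summation convention), and $\theta^\alpha:=\theta^\alpha_\emptyset$; $\theta^\alpha_i$ is the case $I=(i)$. $\Omega^{n,s}=\Omega^{n,s}(J^\infty E)$ is the $\mathcal R^\infty$-module of finite $\mathcal R^\infty$-linear combinations of $\theta^{\alpha_1}_{I_1}\wedge\cdots\wedge\theta^{\alpha_s}_{I_s}\wedge\nu$. For $l\ge0$, $\mathrm{F}^l\Omega^{n,s}$ is the $\mathcal R^\infty$-span of those with $|I_1|+\cdots+|I_s|\le l$, and $\mathrm{Gr}^1\Omega^{n,s}=\mathrm{F}^1\Omega^{n,s}/\mathrm{F}^0\Omega^{n,s}$; classes are denoted by their representatives. The total derivative is $D_j=\frac{\partial}{\partial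 x^j}+\sum_{|I|\ge0}u^\alpha_{Ij}\frac{\partial}{\partial u^\alpha_I}$; it acts on forms by Lie derivative, so $D_j\theta^\alpha_I=\theta^\alpha_{Ij}$ and $D_jdx^i=0$. For $I=(i_1,\dots,i_k)$, $(-D)_I=(-1)^kD_{i_1}\cdots D_{i_k}$. Put $\partial^I_\alpha=\partial/\partial u^\alpha_I$. For $s\ge1$ the interior Euler operator is the $\mathbb R$-linear map $I\colon\Omega^{n,s}\to\Omega^{n,s}$, $$I(\omega)=\frac1s\,\theta^\alpha\wedge\sum_{|I|\ge0}(-D)_I\big(\partial^I_\alpha\lrcorner\,\omega\big),$$ the sum being over all unordered multi-indices (the letter $I$ is used both for the operator and for multi-indices). It maps each $\mathrm{F}^l\Omega^{n,s}$ into itself, and $\bar I_1\colon\mathrm{Gr}^1\Omega^{n,s}\to\mathrm{Gr}^1\Omega^{n,s}$ denotes the induced map $\omega+\mathrm{F}^0\Omega^{n,s}\mapsto I(\omega)+\mathrm{F}^0\Omega^{n,s}$. *)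

theory Defs
  imports
    "HOL-Analysis.Analysis"
    "HOL-Library.Multiset"
    "HOL-Library.Function_Algebras"
    "HOL-Library.Groups_Big_Fun"
    "HOL-Algebra.Coset"
begin

text \<open>
  Everything lives over an adapted chart of the bundle E: base coordinates are indexed by the type
  \<open>'n\<close>, fibre coordinates by the type \<open>'m\<close>, and the chart domain is an open set \<open>W\<close> of pairs (x, u).
  The order on \<open>'n\<close> only serves to list the base coordinates.
\<close>

section \<open>Coordinates and functions of finite order\<close>

text \<open>
  \<open>Fib \<alpha> I\<close> is the coordinate \<open>u\<close> with upper index \<open>\<alpha>\<close> and lower multi-index \<open>I\<close>.  Unordered multi-indices
  are multisets, \<open>Ij\<close> is \<open>add_mset j I\<close> and the length of \<open>I\<close> is \<open>size I\<close>.
\<close>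

datatype ('n, 'm) jvar = Base 'n | Fib 'm "'n multiset"

type_synonym ('n, 'm) chart = "((real, 'n) vec \<times> (real, 'm) vec) set"
type_synonym ('n, 'm) jet = "('n, 'm) jvar \<Rightarrow> real"
type_synonym ('n, 'm) tangent = "('n, 'm) jvar \<Rightarrow> real"

fun jorder :: "('n, 'm) jvar \<Rightarrow> nat" where
  "jorder (Base i) = 0"
| "jorder (Fib \<alpha> I) = size I"

definition base_pt :: "('n::finite, 'm) jet \<Rightarrow> real ^ 'n" where
  "base_pt z = (\<chi> i. z (Base i))"

definition fib_pt :: "('n, 'm::finite) jet \<Rightarrow> real ^ 'm" where
  "fib_pt z = (\<chi> \<alpha>. z (Fib \<alpha> {#}))"

definition jets :: "('n::finite, 'm::finite) chart \<Rightarrow> ('n, 'm) jet set" where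
  "jets W = {z. (base_pt z, fib_pt z) \<in> W}"

definition pd :: "('n, 'm) jvar \<Rightarrow> (('n, 'm) jet \<Rightarrow> real) \<Rightarrow> ('n, 'm) jet \<Rightarrow> real" where
  "pd c f z = deriv (\<lambda>t. f (z(c := t))) (z c)"

text \<open>
  Continuity refers to the product topology; for a function that factors through a finite jet space it
  is ordinary continuity there.
\<close>

fun Ck_on :: "nat \<Rightarrow> ('n, 'm) jet set \<Rightarrow> (('n, 'm) jet \<Rightarrow> real) \<Rightarrow> bool" where
  "Ck_on 0 S f \<longleftrightarrow> continuous_on S f"
| "Ck_on (Suc k) S f \<longleftrightarrow> continuous_on S f \<and>
     (\<forall>c. (\<forall>z\<in>S. (\<lambda>t. f (z(c := t))) differentiable at (z c)) \<and> Ck_on k S (pd c f))"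

definition finite_order_on :: "('n, 'm) jet set \<Rightarrow> (('n, 'm) jet \<Rightarrow> real) \<Rightarrow> bool" where
  "finite_order_on S f \<longleftrightarrow>
     (\<exists>k. \<forall>z\<in>S. \<forall>z'\<in>S. (\<forall>c. jorder c \<le> k \<longrightarrow> z c = z' c) \<longrightarrow> f z = f z')"

definition jsmooth :: "('n, 'm) jet set \<Rightarrow> (('n, 'm) jet \<Rightarrow> real) \<Rightarrow> bool" where
  "jsmooth S f \<longleftrightarrow> finite_order_on S f \<and> (\<forall>k. Ck_on k S f)"

text \<open>
  Functions on the chart are extended by 0 outside of it, so that equality of functions (and below of
  forms) is equality on the chart.
\<close>

definition Rinf :: "('n::finite, 'm::finite) chart \<Rightarrow> (('n, 'm) jet \<Rightarrow> real) set" where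
  "Rinf W = {f. jsmooth (jets W) f \<and> (\<forall>z. z \<notin> jets W \<longrightarrow> f z = 0)}"

section \<open>Differential forms\<close>

text \<open>
  A form takes a point and a list of tangent vectors.  A p-form is one that vanishes on all lists of
  length other than p, so degrees need not be carried around.
\<close>

type_synonym ('n, 'm) form = "('n, 'm) jet \<Rightarrow> ('n, 'm) tangent list \<Rightarrow> real"

definition smul :: "(('n, 'm) jet \<Rightarrow> real) \<Rightarrow> ('n, 'm) form \<Rightarrow> ('n, 'm) form" where
  "smul f \<omega> = (\<lambda>z vs. f z * \<omega> z vs)"

definition zero_form :: "(('n, 'm) jet \<Rightarrow> real) \<Rightarrow> ('n, 'm) form" where
  "zero_form f = (\<lambda>z vs. if vs = [] then f z else 0)"

definition dcoord :: "('n, 'm) jvar \<Rightarrow> ('n, 'm) form" where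
  "dcoord c = (\<lambda>z vs. if length vs = 1 then hd vs c else 0)"

text \<open>
  The exterior product as a sum over shuffles: \<open>S\<close> is the set of positions whose vectors are fed to the
  left factor, and the sign is that of the permutation listing \<open>S\<close> before its complement.
\<close>

definition wedge :: "('n, 'm) form \<Rightarrow> ('n, 'm) form \<Rightarrow> ('n, 'm) form" (infixr \<open>\<and>\<^sub>w\<close> 70) where
  "(\<omega> \<and>\<^sub>w \<eta>) = (\<lambda>z vs. \<Sum>S\<in>Pow {..<length vs}.
     (-1) ^ card {(a, b). a < b \<and> a \<notin> S \<and> b \<in> S} * \<omega> z (nths vs S) * \<eta> z (nths vs (- S)))"

definition contract :: "('n, 'm) tangent \<Rightarrow> ('n, 'm) form \<Rightarrow> ('n, 'm) form" where
  "contract v \<omega> = (\<lambda>z vs. \<omega> z (v # vs))"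

definition coord_vec :: "('n, 'm) jvar \<Rightarrow> ('n, 'm) tangent" where
  "coord_vec c = (\<lambda>c'. if c' = c then 1 else 0)"

text \<open>Directional derivative; the sum is finite for functions of finite order.\<close>

definition dird :: "('n, 'm) tangent \<Rightarrow> (('n, 'm) jet \<Rightarrow> real) \<Rightarrow> ('n, 'm) jet \<Rightarrow> real" where
  "dird v f z = Sum_any (\<lambda>c. v c * pd c f z)"

text \<open>
  The Lie derivative along a vector field \<open>X\<close>, evaluated on vectors \<open>v\<close> regarded as constant vector
  fields: \<open>X (\<omega>(v\<^sub>1,\<dots>,v\<^sub>p))\<close> minus the terms with \<open>[X, v\<^sub>i]\<close> in the i-th slot, where \<open>[X, v]\<close> is minus
  the derivative of \<open>X\<close> in direction \<open>v\<close>.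
\<close>

definition lie ::
  "('n::finite, 'm::finite) chart \<Rightarrow> (('n, 'm) jet \<Rightarrow> ('n, 'm) tangent)
    \<Rightarrow> ('n, 'm) form \<Rightarrow> ('n, 'm) form" where
  "lie W X \<omega> = (\<lambda>z vs. if z \<in> jets W
     then dird (X z) (\<lambda>y. \<omega> y vs) z
          + (\<Sum>i<length vs. \<omega> z (vs[i := (\<lambda>c. dird (vs ! i) (\<lambda>y. X y c) z)]))
     else 0)"

fun total_vf :: "'n \<Rightarrow> ('n, 'm) jet \<Rightarrow> ('n, 'm) tangent" where
  "total_vf j z (Base i) = (if i = j then 1 else 0)"
| "total_vf j z (Fib \<alpha> I) = z (Fib \<alpha> (add_mset j I))"

definition Dtot ::
  "('n::finite, 'm::finite) chart \<Rightarrow> 'n \<Rightarrow> ('n, 'm) form \<Rightarrow> ('n, 'm) form" where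
  "Dtot W j = lie W (total_vf j)"

text \<open>
  Total derivatives commute on forms of finite order, so the order in which the entries of the
  multi-index are listed is immaterial.
\<close>

definition neg_D ::
  "('n::{finite,linorder}, 'm::finite) chart \<Rightarrow> 'n multiset
    \<Rightarrow> ('n, 'm) form \<Rightarrow> ('n, 'm) form" where
  "neg_D W I \<omega> = foldr (\<lambda>j \<phi>. - Dtot W j \<phi>) (sorted_list_of_multiset I) \<omega>"

section \<open>Contact forms and the filtered module\<close>

definition theta :: "'m \<Rightarrow> 'n::finite multiset \<Rightarrow> ('n, 'm) form" where
  "theta \<alpha> I = dcoord (Fib \<alpha> I)
     - (\<Sum>j\<in>UNIV. smul (\<lambda>z. z (Fib \<alpha> (add_mset j I))) (dcoord (Base j)))"

text \<open>
  In the chart a volume form on the base is \<open>\<rho> dx\<^sup>1 \<and> \<dots> \<and> dx\<^sup>n\<close> with a nowhere vanishing smooth function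
  \<open>\<rho>\<close> of the base coordinates.
\<close>

definition volume_density ::
  "('n::finite, 'm::finite) chart \<Rightarrow> ((real, 'n) vec \<Rightarrow> real) \<Rightarrow> bool" where
  "volume_density W \<rho> \<longleftrightarrow> jsmooth (jets W) (\<lambda>z. \<rho> (base_pt z)) \<and> (\<forall>x\<in>fst ` W. \<rho> x \<noteq> 0)"

definition vol :: "((real, 'n::{finite,linorder}) vec \<Rightarrow> real) \<Rightarrow> ('n, 'm) form" where
  "vol \<rho> = smul (\<lambda>z. \<rho> (base_pt z))
     (foldr (\<lambda>i \<phi>. dcoord (Base i) \<and>\<^sub>w \<phi>) (sorted_list_of_set UNIV) (zero_form (\<lambda>_. 1)))"

definition monomial ::
  "((real, 'n::{finite,linorder}) vec \<Rightarrow> real) \<Rightarrow> ('m \<times> 'n multiset) list \<Rightarrow> ('n, 'm) form" where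
  "monomial \<rho> js = foldr (\<lambda>(\<alpha>, I) \<phi>. theta \<alpha> I \<and>\<^sub>w \<phi>) js (vol \<rho>)"

definition Rspan ::
  "('n::finite, 'm::finite) chart \<Rightarrow> ('n, 'm) form set \<Rightarrow> ('n, 'm) form set" where
  "Rspan W B = {\<Sum>b\<in>T. smul (f b) b | T f. finite T \<and> T \<subseteq> B \<and> (\<forall>b\<in>T. f b \<in> Rinf W)}"

definition Fil ::
  "('n::{finite,linorder}, 'm::finite) chart \<Rightarrow> ((real, 'n) vec \<Rightarrow> real) \<Rightarrow> nat \<Rightarrow> nat
    \<Rightarrow> ('n, 'm) form set" where
  "Fil W \<rho> s l = Rspan W {monomial \<rho> js | js. length js = s \<and> (\<Sum>(\<alpha>, I)\<leftarrow>js. size I) \<le> l}"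

definition Fil_group ::
  "('n::{finite,linorder}, 'm::finite) chart \<Rightarrow> ((real, 'n) vec \<Rightarrow> real) \<Rightarrow> nat \<Rightarrow> nat
    \<Rightarrow> ('n, 'm) form monoid" where
  "Fil_group W \<rho> s l = \<lparr>carrier = Fil W \<rho> s l, mult = (+), one = 0\<rparr>"

definition Gr1 ::
  "('n::{finite,linorder}, 'm::finite) chart \<Rightarrow> ((real, 'n) vec \<Rightarrow> real) \<Rightarrow> nat
    \<Rightarrow> ('n, 'm) form set monoid" where
  "Gr1 W \<rho> s = Fil_group W \<rho> s 1 Mod Fil W \<rho> s 0"

definition gr1_class ::
  "('n::{finite,linorder}, 'm::finite) chart \<Rightarrow> ((real, 'n) vec \<Rightarrow> real) \<Rightarrow> nat
    \<Rightarrow> ('n, 'm) form \<Rightarrow> ('n, 'm) form set" where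
  "gr1_class W \<rho> s \<omega> = Fil W \<rho> s 0 #>\<^bsub>Fil_group W \<rho> s 1\<^esub> \<omega>"

section \<open>The interior Euler operator\<close>

text \<open>
  The sum over all multi-indices has finitely many non-zero terms when \<open>\<omega>\<close> involves finitely many
  contact forms.
\<close>

definition interior_euler ::
  "('n::{finite,linorder}, 'm::finite) chart \<Rightarrow> nat
    \<Rightarrow> ('n, 'm) form \<Rightarrow> ('n, 'm) form" where
  "interior_euler W s \<omega> = smul (\<lambda>_. 1 / real s)
     (\<Sum>\<alpha>\<in>UNIV. theta \<alpha> {#} \<and>\<^sub>w
        Sum_any (\<lambda>I. neg_D W I (contract (coord_vec (Fib \<alpha> I)) \<omega>)))"

definition euler_gr1 ::
  "('n::{finite,linorder}, 'm::finite) chart \<Rightarrow> ((real, 'n) vec \<Rightarrow> real) \<Rightarrow> nat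
    \<Rightarrow> ('n, 'm) form set \<Rightarrow> ('n, 'm) form set" where
  "euler_gr1 W \<rho> s C = (\<Union>\<omega>\<in>C. gr1_class W \<rho> s (interior_euler W s \<omega>))"

section \<open>Coefficients of degree-one elements\<close>

text \<open>
  \<open>A i \<alpha>s\<close> is the coefficient with upper index \<open>i\<close> and lower indices \<open>\<alpha>s\<close>, a list of length \<open>s\<close>; list
  positions start at 0, so the first \<open>s - 1\<close> indices are at the positions below \<open>s - 1\<close>.
\<close>

type_synonym ('n, 'm) coeffs = "'n \<Rightarrow> 'm list \<Rightarrow> ('n, 'm) jet \<Rightarrow> real"

definition admissible ::
  "('n::finite, 'm::finite) chart \<Rightarrow> nat \<Rightarrow> ('n, 'm) coeffs \<Rightarrow> bool" where
  "admissible W s A \<longleftrightarrow>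
     (\<forall>i \<alpha>s. length \<alpha>s = s \<longrightarrow> A i \<alpha>s \<in> Rinf W) \<and>
     (\<forall>i \<alpha>s p q. length \<alpha>s = s \<and> p < q \<and> q < s - 1 \<longrightarrow>
        A i (\<alpha>s[p := \<alpha>s ! q, q := \<alpha>s ! p]) = - A i \<alpha>s)"

definition eta ::
  "((real, 'n::{finite,linorder}) vec \<Rightarrow> real) \<Rightarrow> nat \<Rightarrow> ('n, 'm::finite) coeffs \<Rightarrow> ('n, 'm) form" where
  "eta \<rho> s A = (\<Sum>i\<in>UNIV. \<Sum>\<alpha>s\<in>{\<alpha>s. length \<alpha>s = s}.
     smul (A i \<alpha>s) (monomial \<rho> (map (\<lambda>\<alpha>. (\<alpha>, {#})) (butlast \<alpha>s) @ [(last \<alpha>s, {#i#})])))"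

text \<open>\<open>rotate k \<alpha>s\<close> lists \<open>\<alpha>\<^sub>k\<^sub>+\<^sub>1, \<dots>, \<alpha>\<^sub>s, \<alpha>\<^sub>1, \<dots>, \<alpha>\<^sub>k\<close>.\<close>

definition cyclic_sum :: "nat \<Rightarrow> ('n, 'm) coeffs \<Rightarrow> ('n, 'm) coeffs" where
  "cyclic_sum s A i \<alpha>s z = (\<Sum>k<s. (-1) ^ ((s - 1) * k) * A i (rotate k \<alpha>s) z)"

end

theory Submission
  imports Defs
begin

text \<open>
  Modulo forms of order zero only the leading coefficients of an element of \<open>Fil W \<rho> s 1\<close> matter, and on
  these the interior Euler operator acts algebraically.  Let \<open>T\<close> be the signed cyclic sum in the statement.
  The contraction with a coordinate vector of order zero counts the \<open>s - 1\<close> undifferentiated factors.  In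
  a contraction of order one followed by a total derivative, the terms in which the coefficient or the
  density is differentiated have order zero and drop out, and each remaining term exchanges the
  differentiated factor with an undifferentiated one.  Collecting signs, the operator acts as \<open>1 - T / s\<close>
  (\<open>contact_coeff_interior_euler\<close>).  Since \<open>T T = s T\<close> (\<open>cyclic_sum_idempotent\<close>), this is the projection
  along the image of \<open>T\<close> onto the kernel of \<open>T\<close>: its image consists of the coefficients \<open>A\<close> with \<open>T A = 0\<close>
  and its kernel of those with \<open>s A = T A\<close>.

  The leading coefficients are made precise by \<open>contact_coeff\<close>: a form is evaluated on the fibre
  coordinate vectors dual to the wanted contact factors, followed by the coordinate vectors of the base.
  Alternating families of coefficients and classes of the quotient correspond to each other under \<open>eta\<close>
  and \<open>contact_coeff\<close>.  One direction (\<open>contact_coeff_eta\<close>) and the other (\<open>eta_contact_coeff\<close>) both rest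
  on the fact that summing an alternating function against a Kronecker determinant multiplies it by a
  factorial (\<open>sum_kdet_rows\<close>, \<open>sum_kdet_columns\<close>).

  Evaluating on constant coordinate vectors also makes the action easy to compute.  A total derivative
  differentiates the values on such vectors and shifts the vectors themselves (\<open>Dtot_Cons\<close>,
  \<open>shift_fib_vec\<close>); in the case at hand the values vanish identically and only one shifted term per
  contraction is non-zero (\<open>Dtot_contract_eval\<close>).  The Leibniz rule (\<open>Dtot_wedge\<close>) serves to show that the
  operator preserves the filtration, which needs the smoothness of all coefficients involved.
\<close>

section \<open>Smooth functions of finite order\<close>

text \<open>
  Partial derivatives at a point of \<open>S\<close> see a function only along coordinate lines.  With this much
  openness they depend on the values in \<open>S\<close> alone.
\<close>

definition coord_open :: "('n, 'm) jet set \<Rightarrow> bool" where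
  "coord_open S \<longleftrightarrow> (\<forall>z\<in>S. \<forall>c. \<forall>\<^sub>F t in nhds (z c). z(c := t) \<in> S)"

lemma jets_coord_open:
  fixes W :: "('n::finite, 'm::finite) chart"
  assumes "open W"
  shows "coord_open (jets W)"
  unfolding coord_open_def
proof (intro ballI allI)
  fix z :: "('n, 'm) jet" and c
  assume z: "z \<in> jets W"
  have b: "continuous_on UNIV (\<lambda>t. base_pt (z(c := t)))" for c
    unfolding base_pt_def
    by (intro continuous_on_vec_lambda, rename_tac i, case_tac "c = Base i")
      (auto intro!: continuous_intros)
  have f: "continuous_on UNIV (\<lambda>t. fib_pt (z(c := t)))" for c
    unfolding fib_pt_def
    by (intro continuous_on_vec_lambda, rename_tac \<alpha>, case_tac "c = Fib \<alpha> {#}")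
      (auto intro!: continuous_intros)
  have "open ((\<lambda>t. (base_pt (z(c := t)), fib_pt (z(c := t)))) -` W)"
    using assms b f by (intro open_vimage continuous_on_Pair)
  moreover have "z c \<in> (\<lambda>t. (base_pt (z(c := t)), fib_pt (z(c := t)))) -` W"
    using z by (simp add: jets_def)
  ultimately have "\<forall>\<^sub>F t in nhds (z c). t \<in> (\<lambda>t. (base_pt (z(c := t)), fib_pt (z(c := t)))) -` W"
    by (rule eventually_nhds_in_open)
  then show "\<forall>\<^sub>F t in nhds (z c). z(c := t) \<in> jets W"
    by (simp add: jets_def)
qed

definition pdiff :: "('n, 'm) jvar \<Rightarrow> (('n, 'm) jet \<Rightarrow> real) \<Rightarrow> ('n, 'm) jet \<Rightarrow> bool" where
  "pdiff c f z \<longleftrightarrow> (\<lambda>t. f (z(c := t))) differentiable at (z c)"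

lemma Ck_on_Suc_iff:
  "Ck_on (Suc k) S f \<longleftrightarrow> continuous_on S f \<and> (\<forall>c. (\<forall>z\<in>S. pdiff c f z) \<and> Ck_on k S (pd c f))"
  unfolding pdiff_def Ck_on.simps ..

lemma Ck_on_SucI:
  "continuous_on S f \<Longrightarrow> (\<And>z c. z \<in> S \<Longrightarrow> pdiff c f z) \<Longrightarrow> (\<And>c. Ck_on k S (pd c f))
    \<Longrightarrow> Ck_on (Suc k) S f"
  by (simp add: Ck_on_Suc_iff del: Ck_on.simps)

lemma
  assumes "Ck_on (Suc k) S f"
  shows Ck_on_Suc_continuous: "continuous_on S f"
    and Ck_on_Suc_pdiff: "z \<in> S \<Longrightarrow> pdiff c f z"
    and Ck_on_Suc_pd: "Ck_on k S (pd c f)"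
  using assms by (simp_all add: Ck_on_Suc_iff del: Ck_on.simps)

declare Ck_on.simps(2) [simp del]

lemma pd_deriv: "pdiff c f z \<Longrightarrow> ((\<lambda>t. f (z(c := t))) has_field_derivative pd c f z) (at (z c))"
  unfolding pd_def pdiff_def by (metis DERIV_imp_deriv real_differentiableE)

lemma pd_eqI:
  "((\<lambda>t. f (z(c := t))) has_field_derivative D) (at (z c)) \<Longrightarrow> pd c f z = D \<and> pdiff c f z"
  unfolding pd_def pdiff_def by (auto simp: DERIV_imp_deriv real_differentiable_def)

lemma pd_const [simp]: "pd c (\<lambda>_. k) z = 0"
  by (simp add: pd_def)

lemma pd_coord: "pd c (\<lambda>y. y c') z = (if c' = c then 1 else 0)"
  by (auto simp: pd_def)

lemma pd_add: "pdiff c f z \<Longrightarrow> pdiff c g z \<Longrightarrow>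
    pd c (\<lambda>y. f y + g y) z = pd c f z + pd c g z \<and> pdiff c (\<lambda>y. f y + g y) z"
  by (intro pd_eqI DERIV_add pd_deriv)

lemma pd_mult: "pdiff c f z \<Longrightarrow> pdiff c g z \<Longrightarrow>
    pd c (\<lambda>y. f y * g y) z = pd c f z * g z + pd c g z * f z \<and> pdiff c (\<lambda>y. f y * g y) z"
  using DERIV_mult[OF pd_deriv[where c=c and f=f and z=z] pd_deriv[where c=c and f=g and z=z]] by (intro pd_eqI) simp

lemma pd_inverse: "pdiff c f z \<Longrightarrow> f z \<noteq> 0 \<Longrightarrow>
    pd c (\<lambda>y. inverse (f y)) z = (-1) * pd c f z * (inverse (f z) * inverse (f z))
    \<and> pdiff c (\<lambda>y. inverse (f y)) z"
  using DERIV_inverse_fun[OF pd_deriv[where c=c and f=f and z=z]] by (intro pd_eqI) (simp add: algebra_simps)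

lemma pd_cong:
  assumes "coord_open S" "z \<in> S" "\<forall>y\<in>S. f y = g y"
  shows "pd c f z = pd c g z \<and> (pdiff c f z \<longleftrightarrow> pdiff c g z)"
proof -
  have ev: "\<forall>\<^sub>F t in nhds (z c). f (z(c := t)) = g (z(c := t))"
  proof (rule eventually_mono)
    show "\<forall>\<^sub>F t in nhds (z c). z(c := t) \<in> S"
      using assms(1,2) unfolding coord_open_def by blast
    show "f (z(c := t)) = g (z(c := t))" if "z(c := t) \<in> S" for t
      using that by (rule bspec[OF assms(3)])
  qed
  have eq: "(\<lambda>D. ((\<lambda>t. f (z(c := t))) has_field_derivative D) (at (z c))) =
      (\<lambda>D. ((\<lambda>t. g (z(c := t))) has_field_derivative D) (at (z c)))"
    by (intro ext DERIV_cong_ev ev refl)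
  show ?thesis
    unfolding pd_def pdiff_def deriv_def real_differentiable_def eq by (intro conjI refl)
qed

text \<open>
  \<open>Ck_on\<close> iterates partial derivatives of functions that are given everywhere, so agreement on \<open>S\<close> has
  to be carried along all iterated derivatives.
\<close>

lemma Ck_on_cong:
  assumes "coord_open S" "\<And>y. y \<in> S \<Longrightarrow> f y = g y" "Ck_on k S f"
  shows "Ck_on k S g"
proof -
  have "\<forall>y\<in>S. f y = g y" using assms(2) by simp
  then show ?thesis
    using assms(3)
  proof (induction k arbitrary: f g)
    case 0
    have "continuous_on S f" using "0.prems"(2) by simp
    then have "continuous_on S g"
      by (rule continuous_on_eq) (rule bspec[OF "0.prems"(1)])
    then show ?case by simp
  next
    case (Suc k)
    have pd: "pd c f z = pd c g z \<and> (pdiff c f z \<longleftrightarrow> pdiff c g z)" if "z \<in> S" for c z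
      by (rule pd_cong[OF assms(1) that Suc.prems(1)])
    show ?case
    proof (rule Ck_on_SucI)
      show "continuous_on S g"
        by (rule continuous_on_eq[OF Ck_on_Suc_continuous[OF Suc.prems(2)]])
          (rule bspec[OF Suc.prems(1)])
      show "pdiff c g z" if "z \<in> S" for z c
        using pd[OF that, of c] Ck_on_Suc_pdiff[OF Suc.prems(2) that, of c] by blast
      fix c
      have "\<forall>y\<in>S. pd c f y = pd c g y"
        using pd by blast
      then show "Ck_on k S (pd c g)"
        by (rule Suc.IH[OF _ Ck_on_Suc_pd[OF Suc.prems(2)]])
    qed
  qed
qed

lemma Ck_on_Suc_imp: "Ck_on (Suc k) S f \<Longrightarrow> Ck_on k S f"
proof (induction k arbitrary: f)
  case (Suc k)
  show ?case
    by (rule Ck_on_SucI[OF Ck_on_Suc_continuous[OF Suc.prems] Ck_on_Suc_pdiff[OF Suc.prems]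
          Suc.IH[OF Ck_on_Suc_pd[OF Suc.prems]]])
next
  case 0
  then show ?case by (simp add: Ck_on_Suc_continuous)
qed

lemma Ck_on_const: "Ck_on k S (\<lambda>_. r)"
proof (induction k arbitrary: r)
  case (Suc k)
  have "pd c (\<lambda>_. r) = (\<lambda>_. 0)" for c :: "('a, 'b) jvar"
    by (rule ext) simp
  then show ?case using Suc by (intro Ck_on_SucI) (simp_all add: pdiff_def)
qed simp

lemma Ck_on_coord: "Ck_on k S (\<lambda>z. z c)"
proof (cases k)
  case 0
  then show ?thesis
    by (simp add: continuous_on_subset[OF continuous_on_product_coordinates])
next
  case (Suc l)
  have pd: "pd c' (\<lambda>z. z c) = (\<lambda>_. if c = c' then 1 else 0)" for c'
    by (rule ext) (rule pd_coord)
  show ?thesis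
    unfolding Suc
  proof (rule Ck_on_SucI)
    show "continuous_on S (\<lambda>z. z c)"
      by (rule continuous_on_subset[OF continuous_on_product_coordinates subset_UNIV])
    show "pdiff c' (\<lambda>z. z c) z" for z c'
      unfolding pdiff_def by (cases "c = c'") simp_all
    show "Ck_on l S (pd c' (\<lambda>z. z c))" for c'
      unfolding pd by (rule Ck_on_const)
  qed
qed

lemma Ck_on_add:
  assumes S: "coord_open S"
  shows "Ck_on k S f \<Longrightarrow> Ck_on k S g \<Longrightarrow> Ck_on k S (\<lambda>z. f z + g z)"
proof (induction k arbitrary: f g)
  case 0
  then show ?case by (simp add: continuous_on_add)
next
  case (Suc k)
  have pd: "pd c (\<lambda>y. f y + g y) z = pd c f z + pd c g z \<and> pdiff c (\<lambda>y. f y + g y) z"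
    if "z \<in> S" for c z
    by (rule pd_add[OF Ck_on_Suc_pdiff[OF Suc.prems(1) that] Ck_on_Suc_pdiff[OF Suc.prems(2) that]])
  show ?case
  proof (rule Ck_on_SucI)
    show "continuous_on S (\<lambda>z. f z + g z)"
      by (rule continuous_on_add[OF Ck_on_Suc_continuous[OF Suc.prems(1)]
            Ck_on_Suc_continuous[OF Suc.prems(2)]])
    show "pdiff c (\<lambda>z. f z + g z) z" if "z \<in> S" for z c
      using pd[OF that] by (rule conjunct2)
    fix c
    have "Ck_on k S (\<lambda>z. pd c f z + pd c g z)"
      by (rule Suc.IH[OF Ck_on_Suc_pd[OF Suc.prems(1)] Ck_on_Suc_pd[OF Suc.prems(2)]])
    then show "Ck_on k S (pd c (\<lambda>z. f z + g z))"
      by (rule Ck_on_cong[OF S, rotated]) (use pd[of _ c] in simp)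
  qed
qed

lemma Ck_on_mult:
  assumes S: "coord_open S"
  shows "Ck_on k S f \<Longrightarrow> Ck_on k S g \<Longrightarrow> Ck_on k S (\<lambda>z. f z * g z)"
proof (induction k arbitrary: f g)
  case 0
  then show ?case by (simp add: continuous_on_mult)
next
  case (Suc k)
  have pd: "pd c (\<lambda>y. f y * g y) z = pd c f z * g z + pd c g z * f z \<and> pdiff c (\<lambda>y. f y * g y) z"
    if "z \<in> S" for c z
    by (rule pd_mult[OF Ck_on_Suc_pdiff[OF Suc.prems(1) that] Ck_on_Suc_pdiff[OF Suc.prems(2) that]])
  show ?case
  proof (rule Ck_on_SucI)
    show "continuous_on S (\<lambda>z. f z * g z)"
      by (rule continuous_on_mult[OF Ck_on_Suc_continuous[OF Suc.prems(1)]
            Ck_on_Suc_continuous[OF Suc.prems(2)]])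
    show "pdiff c (\<lambda>z. f z * g z) z" if "z \<in> S" for z c
      using pd[OF that] by (rule conjunct2)
    fix c
    have "Ck_on k S (\<lambda>z. pd c f z * g z + pd c g z * f z)"
      by (rule Ck_on_add[OF S Suc.IH[OF Ck_on_Suc_pd[OF Suc.prems(1)] Ck_on_Suc_imp[OF Suc.prems(2)]]
            Suc.IH[OF Ck_on_Suc_pd[OF Suc.prems(2)] Ck_on_Suc_imp[OF Suc.prems(1)]]])
    then show "Ck_on k S (pd c (\<lambda>z. f z * g z))"
      by (rule Ck_on_cong[OF S, rotated]) (use pd[of _ c] in simp)
  qed
qed

lemma Ck_on_inverse:
  assumes S: "coord_open S" and nz: "\<And>z. z \<in> S \<Longrightarrow> f z \<noteq> 0"
  shows "Ck_on k S f \<Longrightarrow> Ck_on k S (\<lambda>z. inverse (f z))"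
proof (induction k)
  case 0
  then show ?case using nz by (simp add: continuous_on_inverse)
next
  case (Suc k)
  have pd: "pd c (\<lambda>y. inverse (f y)) z = (-1) * pd c f z * (inverse (f z) * inverse (f z))
      \<and> pdiff c (\<lambda>y. inverse (f y)) z" if "z \<in> S" for c z
    by (rule pd_inverse[OF Ck_on_Suc_pdiff[OF Suc.prems that] nz[OF that]])
  note IH = Suc.IH[OF Ck_on_Suc_imp[OF Suc.prems]]
  show ?case
  proof (rule Ck_on_SucI)
    show "continuous_on S (\<lambda>z. inverse (f z))"
      using Ck_on_Suc_continuous[OF Suc.prems] nz by (simp add: continuous_on_inverse)
    show "pdiff c (\<lambda>z. inverse (f z)) z" if "z \<in> S" for z c
      using pd[OF that] by (rule conjunct2)
    fix c
    have "Ck_on k S (\<lambda>z. (-1) * pd c f z * (inverse (f z) * inverse (f z)))"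
      by (rule Ck_on_mult[OF S Ck_on_mult[OF S Ck_on_const Ck_on_Suc_pd[OF Suc.prems]]
            Ck_on_mult[OF S IH IH]])
    then show "Ck_on k S (pd c (\<lambda>z. inverse (f z)))"
      by (rule Ck_on_cong[OF S, rotated]) (use pd[of _ c] in simp)
  qed
qed

lemma finite_order_on_mono:
  assumes "\<And>z z'. z \<in> S \<Longrightarrow> z' \<in> S \<Longrightarrow> f z = f z' \<Longrightarrow> g z = g z' \<Longrightarrow> h z = h z'"
    and "finite_order_on S f" "finite_order_on S g"
  shows "finite_order_on S h"
proof -
  obtain k l where
    k: "\<forall>z\<in>S. \<forall>z'\<in>S. (\<forall>c. jorder c \<le> k \<longrightarrow> z c = z' c) \<longrightarrow> f z = f z'" and
    l: "\<forall>z\<in>S. \<forall>z'\<in>S. (\<forall>c. jorder c \<le> l \<longrightarrow> z c = z' c) \<longrightarrow> g z = g z'"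
    using assms(2,3) by (auto simp: finite_order_on_def)
  show ?thesis
    unfolding finite_order_on_def
  proof (intro exI[of _ "max k l"] ballI impI)
    fix z z' assume *: "z \<in> S" "z' \<in> S" "\<forall>c. jorder c \<le> max k l \<longrightarrow> z c = z' c"
    then have "f z = f z'" using k by (meson max.coboundedI1)
    moreover have "g z = g z'" using l * by (meson max.coboundedI2)
    ultimately show "h z = h z'" using assms(1) * by blast
  qed
qed

lemma jsmoothI:
  assumes "\<And>z z'. z \<in> S \<Longrightarrow> z' \<in> S \<Longrightarrow> f z = f z' \<Longrightarrow> g z = g z' \<Longrightarrow> h z = h z'"
    and "jsmooth S f" "jsmooth S g"
    and "\<And>k. Ck_on k S f \<Longrightarrow> Ck_on k S g \<Longrightarrow> Ck_on k S h"
  shows "jsmooth S h"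
  unfolding jsmooth_def
proof (intro conjI allI)
  show "finite_order_on S h"
    using assms(2,3) unfolding jsmooth_def
    by (intro finite_order_on_mono[of S f g h, OF assms(1)]) simp_all
  show "Ck_on k S h" for k
    using assms(2,3) unfolding jsmooth_def by (intro assms(4)) simp_all
qed

lemma jsmooth_cong:
  assumes "coord_open S" "\<And>z. z \<in> S \<Longrightarrow> f z = g z" "jsmooth S f"
  shows "jsmooth S g"
  by (rule jsmoothI[OF _ assms(3) assms(3)]) (simp add: assms(2)[symmetric], rule Ck_on_cong[OF assms(1,2)])

lemma jsmooth_const: "jsmooth S (\<lambda>_. r)"
  by (simp add: jsmooth_def finite_order_on_def Ck_on_const)

lemma jsmooth_coord: "jsmooth S (\<lambda>z. z c)"
  unfolding jsmooth_def finite_order_on_def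
  by (intro conjI allI Ck_on_coord exI[of _ "jorder c"]) blast

lemma jsmooth_add:
  assumes "coord_open S" "jsmooth S f" "jsmooth S g"
  shows "jsmooth S (\<lambda>z. f z + g z)"
  by (rule jsmoothI[OF _ assms(2,3)]) (simp, rule Ck_on_add[OF assms(1)])

lemma jsmooth_mult:
  assumes "coord_open S" "jsmooth S f" "jsmooth S g"
  shows "jsmooth S (\<lambda>z. f z * g z)"
  by (rule jsmoothI[OF _ assms(2,3)]) (simp, rule Ck_on_mult[OF assms(1)])

lemma jsmooth_inverse:
  assumes "coord_open S" "jsmooth S f" "\<And>z. z \<in> S \<Longrightarrow> f z \<noteq> 0"
  shows "jsmooth S (\<lambda>z. inverse (f z))"
  by (rule jsmoothI[OF _ assms(2,2)]) (simp, rule Ck_on_inverse[OF assms(1,3)])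

lemma jsmooth_sum:
  assumes "coord_open S" "\<And>i. i \<in> T \<Longrightarrow> jsmooth S (f i)"
  shows "jsmooth S (\<lambda>z. \<Sum>i\<in>T. f i z)"
  using assms(2)
  by (induction T rule: infinite_finite_induct) (auto intro: jsmooth_const jsmooth_add[OF assms(1)])

lemma jsmooth_pdiff: "jsmooth S f \<Longrightarrow> z \<in> S \<Longrightarrow> pdiff c f z"
  unfolding jsmooth_def by (meson Ck_on_Suc_pdiff)

text \<open>
  The order of a partial derivative is at most the maximum of the order of the function and that of the
  coordinate: two points that agree up to this order keep agreeing up to the order of the function while
  the coordinate is varied.
\<close>

lemma jsmooth_pd:
  fixes S :: "('n, 'm) jet set"
  assumes S: "coord_open S" and f: "jsmooth S f"
  shows "jsmooth S (pd c f)"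
proof -
  have "Ck_on k S (pd c f)" for k
    using f unfolding jsmooth_def by (meson Ck_on_Suc_pd)
  moreover have "finite_order_on S (pd c f)"
  proof -
    obtain k where k: "\<forall>z\<in>S. \<forall>z'\<in>S. (\<forall>c. jorder c \<le> k \<longrightarrow> z c = z' c) \<longrightarrow> f z = f z'"
      using f by (auto simp: jsmooth_def finite_order_on_def)
    show ?thesis
      unfolding finite_order_on_def
    proof (intro exI[of _ "max k (jorder c)"] ballI impI)
      fix z z' :: "('n, 'm) jet"
      assume *: "z \<in> S" "z' \<in> S" "\<forall>c'. jorder c' \<le> max k (jorder c) \<longrightarrow> z c' = z' c'"
      then have c: "z c = z' c" by simp
      have "\<forall>\<^sub>F t in nhds (z c). z(c := t) \<in> S"
        using S *(1) unfolding coord_open_def by blast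
      moreover have "\<forall>\<^sub>F t in nhds (z c). z'(c := t) \<in> S"
        using S *(2) unfolding coord_open_def c by blast
      ultimately have "\<forall>\<^sub>F t in nhds (z c). f (z(c := t)) = f (z'(c := t))"
      proof eventually_elim
        case (elim t)
        show ?case
          by (rule k[rule_format, OF elim]) (use *(3) in simp)
      qed
      then show "pd c f z = pd c f z'"
        unfolding pd_def c by (intro deriv_cong_ev) auto
    qed
  qed
  ultimately show ?thesis by (simp add: jsmooth_def)
qed

lemma finite_jorder_le: "finite {c :: ('n::finite, 'm::finite) jvar. jorder c \<le> k}"
proof -
  have "{c :: ('n, 'm) jvar. jorder c \<le> k} \<subseteq>
      range Base \<union> (\<lambda>(\<alpha>, I). Fib \<alpha> I) ` (UNIV \<times> (\<Union>l\<le>k. multisets_of_size UNIV l))"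
    (is "_ \<subseteq> ?R")
  proof
    fix c :: "('n, 'm) jvar"
    assume "c \<in> {c. jorder c \<le> k}"
    then show "c \<in> ?R"
      by (cases c) (auto simp: multisets_of_size_def)
  qed
  moreover have "finite ?R"
    by (intro finite_UnI finite_imageI finite_cartesian_product finite_UN_I
        finite_multisets_of_size) simp_all
  ultimately show ?thesis by (rule finite_subset)
qed

text \<open>
  Changing a coordinate of high order neither leaves a chart domain nor changes a function of finite
  order, so only finitely many partial derivatives are non-zero, uniformly on the chart.  Directional
  derivatives thereby become finite sums.
\<close>

lemma jsmooth_pd_support:
  fixes W :: "('n::finite, 'm::finite) chart"
  assumes "jsmooth (jets W) f"
  obtains C where "finite C" "\<And>z c. z \<in> jets W \<Longrightarrow> c \<notin> C \<Longrightarrow> pd c f z = 0"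
proof -
  obtain k where
    k: "\<forall>z\<in>jets W. \<forall>z'\<in>jets W. (\<forall>c. jorder c \<le> k \<longrightarrow> z c = z' c) \<longrightarrow> f z = f z'"
    using assms by (auto simp: jsmooth_def finite_order_on_def)
  have "pd c f z = 0" if "z \<in> jets W" "jorder c > k" for z c
  proof -
    have "Base i \<noteq> c" "Fib \<alpha> {#} \<noteq> c" for i \<alpha>
      using that(2) by auto
    then have j: "z(c := t) \<in> jets W" for t
      using that(1) by (simp add: jets_def base_pt_def fib_pt_def)
    have "f (z(c := t)) = f z" for t
      using that by (intro k[rule_format, OF j]) auto
    then show ?thesis by (simp add: pd_def)
  qed
  then show thesis
    using that[OF finite_jorder_le[of k]] by (metis mem_Collect_eq not_le)
qed

lemma dird_eq_sum:
  assumes "finite C" "\<And>c. c \<notin> C \<Longrightarrow> pd c f z = 0"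
  shows "dird v f z = (\<Sum>c\<in>C. v c * pd c f z)"
  unfolding dird_def by (rule Sum_any.expand_superset) (use assms in auto)

lemma dird_const [simp]: "dird v (\<lambda>_. k) z = 0"
  by (simp add: dird_def)

lemma dird_coord: "dird v (\<lambda>y. y c) z = v c"
  by (subst dird_eq_sum[of "{c}"]) (auto simp: pd_coord)

lemma
  fixes W :: "('n::finite, 'm::finite) chart"
  assumes f: "jsmooth (jets W) f" and g: "jsmooth (jets W) g" and z: "z \<in> jets W"
  shows dird_add: "dird v (\<lambda>y. f y + g y) z = dird v f z + dird v g z"
    and dird_mult: "dird v (\<lambda>y. f y * g y) z = dird v f z * g z + f z * dird v g z"
proof -
  obtain C D where C: "finite C" "\<And>z c. z \<in> jets W \<Longrightarrow> c \<notin> C \<Longrightarrow> pd c f z = 0"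
    and D: "finite D" "\<And>z c. z \<in> jets W \<Longrightarrow> c \<notin> D \<Longrightarrow> pd c g z = 0"
    using jsmooth_pd_support[OF f] jsmooth_pd_support[OF g] by metis
  note pds = jsmooth_pdiff[OF f z] jsmooth_pdiff[OF g z]
  have f': "dird v f z = (\<Sum>c\<in>C \<union> D. v c * pd c f z)"
    and g': "dird v g z = (\<Sum>c\<in>C \<union> D. v c * pd c g z)"
    using C D z by (auto intro!: dird_eq_sum)
  have "dird v (\<lambda>y. f y + g y) z = (\<Sum>c\<in>C \<union> D. v c * pd c (\<lambda>y. f y + g y) z)"
    using C D z pds by (intro dird_eq_sum) (auto simp: pd_add)
  then show "dird v (\<lambda>y. f y + g y) z = dird v f z + dird v g z"
    using pds by (simp add: f' g' pd_add algebra_simps sum.distrib)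
  have "dird v (\<lambda>y. f y * g y) z = (\<Sum>c\<in>C \<union> D. v c * pd c (\<lambda>y. f y * g y) z)"
    using C D z pds by (intro dird_eq_sum) (auto simp: pd_mult)
  then show "dird v (\<lambda>y. f y * g y) z = dird v f z * g z + f z * dird v g z"
    using pds by (simp add: f' g' pd_mult algebra_simps sum.distrib sum_distrib_left)
qed

lemma jsmooth_dird:
  fixes W :: "('n::finite, 'm::finite) chart"
  assumes "open W" and f: "jsmooth (jets W) f" and X: "\<And>c. jsmooth (jets W) (\<lambda>z. X z c)"
  shows "jsmooth (jets W) (\<lambda>z. dird (X z) f z)"
proof -
  note S = jets_coord_open[OF assms(1)]
  obtain C where C: "finite C" "\<And>z c. z \<in> jets W \<Longrightarrow> c \<notin> C \<Longrightarrow> pd c f z = 0"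
    using jsmooth_pd_support[OF f] by metis
  have "jsmooth (jets W) (\<lambda>z. \<Sum>c\<in>C. X z c * pd c f z)"
    by (intro jsmooth_sum[OF S] jsmooth_mult[OF S] X jsmooth_pd[OF S f])
  then show ?thesis
    by (rule jsmooth_cong[OF S, rotated]) (use C in \<open>auto intro!: dird_eq_sum[symmetric]\<close>)
qed

lemma jsmooth_total_vf: "jsmooth S (\<lambda>z. total_vf j z c)"
  by (cases c) (auto intro: jsmooth_const jsmooth_coord)

lemma Rinf_zero: "(\<lambda>_. 0) \<in> Rinf W"
  by (simp add: Rinf_def jsmooth_const)

lemma Rinf_add:
  "open W \<Longrightarrow> f \<in> Rinf W \<Longrightarrow> g \<in> Rinf W \<Longrightarrow> (\<lambda>z. f z + g z) \<in> Rinf W"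
  by (simp add: Rinf_def jsmooth_add jets_coord_open)

lemma Rinf_mult:
  "open W \<Longrightarrow> f \<in> Rinf W \<Longrightarrow> jsmooth (jets W) h \<Longrightarrow> (\<lambda>z. f z * h z) \<in> Rinf W"
  by (simp add: Rinf_def jsmooth_mult jets_coord_open)

lemma Rinf_scale: "open W \<Longrightarrow> f \<in> Rinf W \<Longrightarrow> (\<lambda>z. r * f z) \<in> Rinf W"
  by (simp add: Rinf_def jsmooth_mult jets_coord_open jsmooth_const)

lemma Rinf_restrict:
  fixes W :: "('n::finite, 'm::finite) chart"
  assumes "open W" "jsmooth (jets W) f"
  shows "(\<lambda>z. if z \<in> jets W then f z else 0) \<in> Rinf W"
  using jsmooth_cong[OF jets_coord_open[OF assms(1)] _ assms(2)] by (simp add: Rinf_def)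

section \<open>Exterior multiplication by one-forms\<close>

lemma sum_form_apply:
  fixes F :: "'i \<Rightarrow> ('n, 'm) form"
  shows "(\<Sum>i\<in>T. F i) z vs = (\<Sum>i\<in>T. F i z vs)"
  by (induction T rule: infinite_finite_induct) auto

definition del :: "nat \<Rightarrow> 'a list \<Rightarrow> 'a list" where
  "del r xs = take r xs @ drop (Suc r) xs"

lemma del_Cons_0 [simp]: "del 0 (x # xs) = xs"
  and del_Cons_Suc [simp]: "del (Suc r) (x # xs) = x # del r xs"
  by (simp_all add: del_def)

lemma length_del: "r < length xs \<Longrightarrow> length (del r xs) = length xs - 1"
  by (simp add: del_def)

lemma nths_del: "r < length xs \<Longrightarrow> nths xs {r} = [xs ! r] \<and> nths xs (- {r}) = del r xs"
proof (induction xs arbitrary: r)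
  case (Cons x xs)
  show ?case
  proof (cases r)
    case 0
    have "{j. Suc j \<in> {0}} = {}" "{j. Suc j \<in> - {0}} = UNIV" by auto
    then show ?thesis using 0 by (simp add: nths_Cons nths_all)
  next
    case (Suc k)
    have "{j. Suc j \<in> {Suc k}} = {k}" "{j. Suc j \<in> - {Suc k}} = - {k}" by auto
    then show ?thesis using Suc Cons by (simp add: nths_Cons)
  qed
qed simp

definition one_form :: "('n, 'm) form \<Rightarrow> bool" where
  "one_form \<omega> \<longleftrightarrow> (\<forall>z vs. length vs \<noteq> 1 \<longrightarrow> \<omega> z vs = 0)"

text \<open>
  Only the shuffles that feed a single position to the one-form survive, and moving the position \<open>r\<close> to
  the front takes \<open>r\<close> transpositions.
\<close>

lemma wedge_one_form:
  assumes "one_form \<omega>"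
  shows "(\<omega> \<and>\<^sub>w \<phi>) z vs = (\<Sum>r<length vs. (-1) ^ r * \<omega> z [vs ! r] * \<phi> z (del r vs))"
proof -
  let ?N = "length vs"
  let ?t = "\<lambda>S. (-1) ^ card {(a, b). a < b \<and> a \<notin> S \<and> b \<in> S} * \<omega> z (nths vs S) * \<phi> z (nths vs (- S))"
  have "?t S = 0" if S: "S \<in> Pow {..<?N} - (\<lambda>r. {r}) ` {..<?N}" for S
  proof -
    have "{i. i < ?N \<and> i \<in> S} = S" using S by auto
    moreover have "card S \<noteq> 1"
      using S by (auto simp: card_1_singleton_iff)
    ultimately have "length (nths vs S) \<noteq> 1" by (simp add: length_nths)
    then show ?thesis using assms by (simp add: one_form_def)
  qed
  then have "(\<omega> \<and>\<^sub>w \<phi>) z vs = sum ?t ((\<lambda>r. {r}) ` {..<?N})"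
    unfolding wedge_def by (intro sum.mono_neutral_right) auto
  also have "\<dots> = (\<Sum>r<?N. ?t {r})"
    by (subst sum.reindex) (auto simp: inj_on_def)
  also have "\<dots> = (\<Sum>r<?N. (-1) ^ r * \<omega> z [vs ! r] * \<phi> z (del r vs))"
  proof (rule sum.cong[OF refl])
    fix r assume r: "r \<in> {..<?N}"
    have "{(a, b). a < b \<and> a \<notin> {r} \<and> b \<in> {r}} = (\<lambda>a. (a, r)) ` {..<r}" by auto
    then have "card {(a, b). a < b \<and> a \<notin> {r} \<and> b \<in> {r}} = r"
      by (simp add: card_image inj_on_def)
    then show "?t {r} = (-1) ^ r * \<omega> z [vs ! r] * \<phi> z (del r vs)"
      using r nths_del[of r vs] by simp
  qed
  finally show ?thesis .
qed

lemma wedge_Nil: "one_form \<omega> \<Longrightarrow> (\<omega> \<and>\<^sub>w \<phi>) z [] = 0"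
  by (simp add: wedge_one_form)

text \<open>
  Contraction is an antiderivation.  Together with the vanishing on the empty list this determines the
  product with a one-form recursively, and the identities below follow by induction on the list of
  tangent vectors.
\<close>

lemma wedge_Cons:
  assumes "one_form \<omega>"
  shows "(\<omega> \<and>\<^sub>w \<phi>) z (v # vs) = \<omega> z [v] * \<phi> z vs - (\<omega> \<and>\<^sub>w contract v \<phi>) z vs"
  by (simp add: wedge_one_form[OF assms] sum.lessThan_Suc_shift contract_def sum_negf
      del: sum.lessThan_Suc)

lemma contract_wedge:
  "one_form \<omega> \<Longrightarrow> contract v (\<omega> \<and>\<^sub>w \<phi>) = smul (\<lambda>z. \<omega> z [v]) \<phi> - (\<omega> \<and>\<^sub>w contract v \<phi>)"
  by (intro ext) (simp add: contract_def[of v "\<omega> \<and>\<^sub>w \<phi>"] wedge_Cons smul_def)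

lemma wedge_cong:
  assumes "\<And>us. \<omega> z us = \<omega>' z us" "\<And>us. \<phi> z us = \<psi> z us"
  shows "(\<omega> \<and>\<^sub>w \<phi>) z vs = (\<omega>' \<and>\<^sub>w \<psi>) z vs"
  by (simp add: wedge_def assms)

lemma wedge_add: "(\<omega> \<and>\<^sub>w (\<phi> + \<psi>)) = (\<omega> \<and>\<^sub>w \<phi>) + (\<omega> \<and>\<^sub>w \<psi>)"
  by (intro ext) (simp add: wedge_def algebra_simps sum.distrib)

lemma wedge_smul: "(\<omega> \<and>\<^sub>w smul f \<phi>) = smul f (\<omega> \<and>\<^sub>w \<phi>)"
  by (intro ext) (simp add: wedge_def smul_def sum_distrib_left algebra_simps)

lemma wedge_zero [simp]: "(\<omega> \<and>\<^sub>w 0) = 0"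
  by (intro ext) (simp add: wedge_def)

lemma wedge_minus: "(\<omega> \<and>\<^sub>w (- \<phi>)) = - (\<omega> \<and>\<^sub>w \<phi>)"
  using wedge_smul[of \<omega> "\<lambda>_. -1" \<phi>] by (simp add: smul_def fun_Compl_def)

lemma wedge_diff: "(\<omega> \<and>\<^sub>w (\<phi> - \<psi>)) = (\<omega> \<and>\<^sub>w \<phi>) - (\<omega> \<and>\<^sub>w \<psi>)"
  using wedge_add[of \<omega> \<phi> "- \<psi>"] by (simp add: wedge_minus)

lemma wedge_sum: "(\<omega> \<and>\<^sub>w (\<Sum>i\<in>T. \<phi> i)) = (\<Sum>i\<in>T. \<omega> \<and>\<^sub>w \<phi> i)"
  by (induction T rule: infinite_finite_induct)
    (simp_all only: sum.infinite sum.empty sum.insert wedge_zero wedge_add not_False_eq_True)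

lemma smul_apply: "smul f \<omega> z vs = f z * \<omega> z vs"
  by (simp add: smul_def)

lemma contract_apply: "contract v \<omega> z vs = \<omega> z (v # vs)"
  by (simp add: contract_def)

text \<open>
  Both sides satisfy the recursion of \<open>wedge_Cons\<close>, in which the two scalar terms get opposite signs.
\<close>

lemma wedge_anticommute:
  fixes \<phi> :: "('n, 'm) form"
  assumes \<theta>: "one_form \<theta>" and \<theta>': "one_form \<theta>'"
  shows "(\<theta> \<and>\<^sub>w (\<theta>' \<and>\<^sub>w \<phi>)) = - (\<theta>' \<and>\<^sub>w (\<theta> \<and>\<^sub>w \<phi>))"
proof (intro ext)
  fix z :: "('n, 'm) jet" and vs
  show "(\<theta> \<and>\<^sub>w (\<theta>' \<and>\<^sub>w \<phi>)) z vs = (- (\<theta>' \<and>\<^sub>w (\<theta> \<and>\<^sub>w \<phi>))) z vs"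
  proof (induction vs arbitrary: \<phi>)
    case Nil
    then show ?case by (simp add: wedge_Nil \<theta> \<theta>')
  next
    case (Cons v vs)
    show ?case
      using Cons[of "contract v \<phi>"]
      by (simp add: wedge_Cons \<theta> \<theta>' contract_wedge wedge_diff wedge_smul smul_apply)
  qed
qed

definition alternating :: "('n, 'm) form \<Rightarrow> bool" where
  "alternating \<phi> \<longleftrightarrow> (\<forall>z us a b vs. \<phi> z (us @ a # b # vs) = - \<phi> z (us @ b # a # vs))"

lemma alternatingD: "alternating \<phi> \<Longrightarrow> \<phi> z (us @ a # b # vs) = - \<phi> z (us @ b # a # vs)"
  unfolding alternating_def by blast

lemma alternating_contract: "alternating \<phi> \<Longrightarrow> alternating (contract v \<phi>)"
  unfolding alternating_def contract_def by (metis append_Cons)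

lemma alternating_wedge:
  assumes \<omega>: "one_form \<omega>" and "alternating \<phi>"
  shows "alternating (\<omega> \<and>\<^sub>w \<phi>)"
proof -
  have "(\<omega> \<and>\<^sub>w \<phi>) z (us @ a # b # vs) = - (\<omega> \<and>\<^sub>w \<phi>) z (us @ b # a # vs)" for z us a b vs
    using assms(2)
  proof (induction us arbitrary: \<phi>)
    case Nil
    have "\<phi> z (b # a # vs) = - \<phi> z (a # b # vs)" for z vs
      using alternatingD[OF Nil, of z "[]" b a vs] by simp
    then have "contract a (contract b \<phi>) = - contract b (contract a \<phi>)"
      by (intro ext) (simp add: contract_def)
    then show ?case
      by (simp add: wedge_Cons[OF \<omega>] contract_apply wedge_minus)
  next
    case (Cons u us)
    show ?case
      using Cons.IH[OF alternating_contract[OF Cons.prems]] alternatingD[OF Cons.prems, of z us a b vs]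
      by (simp add: wedge_Cons[OF \<omega>])
  qed
  then show ?thesis unfolding alternating_def by blast
qed

text \<open>
  The part of multilinearity that matters here: forms built from coordinate differentials vanish as soon
  as one of their arguments does.
\<close>

definition null_vec :: "('n, 'm) form \<Rightarrow> bool" where
  "null_vec \<phi> \<longleftrightarrow> (\<forall>z us vs. \<phi> z (us @ (\<lambda>_. 0) # vs) = 0)"

lemma null_vecD: "null_vec \<phi> \<Longrightarrow> \<phi> z (us @ (\<lambda>_. 0) # vs) = 0"
  unfolding null_vec_def by blast

lemma null_vec_contract: "null_vec \<phi> \<Longrightarrow> null_vec (contract v \<phi>)"
  unfolding null_vec_def contract_def by (metis append_Cons)

lemma null_vec_wedge:
  assumes \<omega>: "one_form \<omega>" "null_vec \<omega>" and "null_vec \<phi>"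
  shows "null_vec (\<omega> \<and>\<^sub>w \<phi>)"
proof -
  have "(\<omega> \<and>\<^sub>w \<phi>) z (us @ (\<lambda>_. 0) # vs) = 0" for z us vs
    using assms(3)
  proof (induction us arbitrary: \<phi>)
    case Nil
    have "contract (\<lambda>_. 0) \<phi> = 0"
      using null_vecD[OF Nil, of _ "[]"] by (intro ext) (simp add: contract_apply)
    then show ?case
      using null_vecD[OF \<omega>(2), of z "[]"] by (simp add: wedge_Cons[OF \<omega>(1)])
  next
    case (Cons u us)
    show ?case
      using Cons.IH[OF null_vec_contract[OF Cons.prems]] null_vecD[OF Cons.prems, of z us vs]
      by (simp add: wedge_Cons[OF \<omega>(1)])
  qed
  then show ?thesis unfolding null_vec_def by blast
qed

definition smooth_form :: "('n::finite, 'm::finite) chart \<Rightarrow> ('n, 'm) form \<Rightarrow> bool" where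
  "smooth_form W \<phi> \<longleftrightarrow> (\<forall>vs. jsmooth (jets W) (\<lambda>z. \<phi> z vs))"

lemma smooth_formD: "smooth_form W \<phi> \<Longrightarrow> jsmooth (jets W) (\<lambda>z. \<phi> z vs)"
  unfolding smooth_form_def by blast

lemma smooth_form_contract: "smooth_form W \<phi> \<Longrightarrow> smooth_form W (contract v \<phi>)"
  unfolding smooth_form_def contract_def by blast

lemma smooth_form_wedge:
  assumes "open W" "smooth_form W \<omega>" "smooth_form W \<phi>"
  shows "smooth_form W (\<omega> \<and>\<^sub>w \<phi>)"
  unfolding smooth_form_def wedge_def
  by (intro allI jsmooth_sum[OF jets_coord_open[OF assms(1)]] jsmooth_mult[OF jets_coord_open[OF assms(1)]]
      jsmooth_const smooth_formD[OF assms(2)] smooth_formD[OF assms(3)])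

lemma smooth_form_smul:
  "open W \<Longrightarrow> jsmooth (jets W) f \<Longrightarrow> smooth_form W \<phi> \<Longrightarrow> smooth_form W (smul f \<phi>)"
  unfolding smooth_form_def smul_def by (simp add: jsmooth_mult jets_coord_open)

lemma smooth_form_add:
  "open W \<Longrightarrow> smooth_form W \<omega> \<Longrightarrow> smooth_form W \<phi> \<Longrightarrow> smooth_form W (\<omega> + \<phi>)"
  unfolding smooth_form_def by (simp add: jsmooth_add jets_coord_open)

section \<open>Total derivatives\<close>

text \<open>
  The bracket term in the Lie derivative along \<open>total_vf j\<close>.  The coefficients of \<open>total_vf j\<close> are
  coordinates, so the bracket with a constant vector field is again constant.
\<close>

definition shift :: "'n \<Rightarrow> ('n, 'm) tangent \<Rightarrow> ('n, 'm) tangent" where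
  "shift j v c = (case c of Base i \<Rightarrow> 0 | Fib \<alpha> I \<Rightarrow> v (Fib \<alpha> (add_mset j I)))"

lemma dird_total_vf: "(\<lambda>c. dird v (\<lambda>y. total_vf j y c) z) = shift j v"
proof
  fix c show "dird v (\<lambda>y. total_vf j y c) z = shift j v c"
    by (cases c) (simp_all add: shift_def dird_coord)
qed

lemma Dtot_outside: "z \<notin> jets W \<Longrightarrow> Dtot W j \<omega> z vs = 0"
  by (simp add: Dtot_def lie_def)

lemma Dtot_apply:
  "z \<in> jets W \<Longrightarrow> Dtot W j \<omega> z vs =
    dird (total_vf j z) (\<lambda>y. \<omega> y vs) z + (\<Sum>i<length vs. \<omega> z (vs[i := shift j (vs ! i)]))"
  by (simp add: Dtot_def lie_def dird_total_vf)

lemma Dtot_Nil: "z \<in> jets W \<Longrightarrow> Dtot W j \<omega> z [] = dird (total_vf j z) (\<lambda>y. \<omega> y []) z"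
  by (simp add: Dtot_apply)

text \<open>
  The total derivative commutes with contraction by a constant vector field up to the bracket term.
\<close>

lemma Dtot_Cons:
  "z \<in> jets W \<Longrightarrow> Dtot W j \<omega> z (v # vs) = Dtot W j (contract v \<omega>) z vs + \<omega> z (shift j v # vs)"
  by (simp add: Dtot_apply contract_def sum.lessThan_Suc_shift del: sum.lessThan_Suc)

lemma Dtot_zero [simp]: "Dtot W j 0 = 0"
  by (intro ext) (simp add: Dtot_def lie_def)

lemma one_form_Dtot:
  assumes "one_form \<omega>"
  shows "one_form (Dtot W j \<omega>)"
  unfolding one_form_def
proof (intro allI impI)
  fix z and vs :: "('a, 'b) tangent list"
  assume "length vs \<noteq> 1"
  then have 0: "\<omega> y vs = 0" "\<omega> y (vs[i := v]) = 0" for y i v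
    using assms by (simp_all add: one_form_def)
  show "Dtot W j \<omega> z vs = 0"
    by (cases "z \<in> jets W") (simp_all add: Dtot_apply Dtot_outside 0)
qed

lemma Dtot_add:
  assumes "smooth_form W \<omega>" "smooth_form W \<phi>"
  shows "Dtot W j (\<omega> + \<phi>) = Dtot W j \<omega> + Dtot W j \<phi>"
proof (intro ext)
  fix z vs
  show "Dtot W j (\<omega> + \<phi>) z vs = (Dtot W j \<omega> + Dtot W j \<phi>) z vs"
    using dird_add[OF smooth_formD[OF assms(1)] smooth_formD[OF assms(2)], of z "total_vf j z" vs vs]
    by (cases "z \<in> jets W") (simp_all add: Dtot_apply Dtot_outside sum.distrib)
qed

lemma Dtot_smul:
  assumes "jsmooth (jets W) f" "smooth_form W \<phi>" "z \<in> jets W"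
  shows "Dtot W j (smul f \<phi>) z vs = dird (total_vf j z) f z * \<phi> z vs + f z * Dtot W j \<phi> z vs"
  using dird_mult[OF assms(1) smooth_formD[OF assms(2)] assms(3), of "total_vf j z" vs]
  by (simp add: Dtot_apply assms(3) smul_apply sum_distrib_left algebra_simps)

lemma Dtot_minus:
  assumes "open W" "smooth_form W \<phi>"
  shows "Dtot W j (- \<phi>) = - Dtot W j \<phi>"
proof (intro ext)
  fix z vs
  have "- \<phi> = smul (\<lambda>_. -1) \<phi>" by (intro ext) (simp add: smul_apply)
  then show "Dtot W j (- \<phi>) z vs = (- Dtot W j \<phi>) z vs"
    using Dtot_smul[OF jsmooth_const assms(2), of z j "-1" vs]
    by (cases "z \<in> jets W") (simp_all add: Dtot_outside)
qed

text \<open>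
  The Leibniz rule.  By \<open>Dtot_Cons\<close> and \<open>wedge_Cons\<close> both sides obey the same recursion over the list
  of tangent vectors; the bracket terms match because they enter the one-form and the other factor
  separately.
\<close>

lemma Dtot_wedge:
  assumes W: "open W" and \<theta>: "one_form \<theta>" "smooth_form W \<theta>" and "smooth_form W \<phi>"
  shows "Dtot W j (\<theta> \<and>\<^sub>w \<phi>) = (Dtot W j \<theta> \<and>\<^sub>w \<phi>) + (\<theta> \<and>\<^sub>w Dtot W j \<phi>)"
proof (intro ext)
  fix z vs
  show "Dtot W j (\<theta> \<and>\<^sub>w \<phi>) z vs = ((Dtot W j \<theta> \<and>\<^sub>w \<phi>) + (\<theta> \<and>\<^sub>w Dtot W j \<phi>)) z vs"
  proof (cases "z \<in> jets W")
    case False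
    then show ?thesis by (simp add: Dtot_outside wedge_def)
  next
    case z: True
    note D\<theta> = one_form_Dtot[OF \<theta>(1), of W j]
    show ?thesis
      using assms(4)
    proof (induction vs arbitrary: \<phi>)
      case Nil
      then show ?case by (simp add: Dtot_Nil z wedge_Nil \<theta> D\<theta>)
    next
      case (Cons v vs)
      note c\<phi> = smooth_form_contract[OF Cons.prems, of v]
      define t where "t = (\<lambda>z. \<theta> z [v])"
      have t: "jsmooth (jets W) t"
        unfolding t_def by (rule smooth_formD[OF \<theta>(2)])
      have Dt: "Dtot W j \<theta> z [v] = dird (total_vf j z) t z + \<theta> z [shift j v]"
        by (simp add: Dtot_apply z t_def)
      have s1: "smooth_form W (\<theta> \<and>\<^sub>w contract v \<phi>)"
        by (rule smooth_form_wedge[OF W \<theta>(2) c\<phi>])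
      have s2: "smooth_form W (- (\<theta> \<and>\<^sub>w contract v \<phi>))"
        using smooth_form_smul[OF W jsmooth_const s1, of "-1"] by (simp add: smul_def fun_Compl_def)
      have "Dtot W j (contract v (\<theta> \<and>\<^sub>w \<phi>)) z vs =
          Dtot W j (smul t \<phi> + - (\<theta> \<and>\<^sub>w contract v \<phi>)) z vs"
        by (simp add: contract_wedge \<theta> t_def)
      also have "\<dots> = dird (total_vf j z) t z * \<phi> z vs + t z * Dtot W j \<phi> z vs
          - Dtot W j (\<theta> \<and>\<^sub>w contract v \<phi>) z vs"
        unfolding Dtot_add[OF smooth_form_smul[OF W t Cons.prems] s2] Dtot_minus[OF W s1]
        by (simp add: Dtot_smul[OF t Cons.prems z])
      finally have l: "Dtot W j (contract v (\<theta> \<and>\<^sub>w \<phi>)) z vs = \<dots>" .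
      have "(\<theta> \<and>\<^sub>w contract v (Dtot W j \<phi>)) z vs =
          (\<theta> \<and>\<^sub>w (Dtot W j (contract v \<phi>) + contract (shift j v) \<phi>)) z vs"
        by (rule wedge_cong) (simp_all add: contract_apply Dtot_Cons z)
      then show ?case
        using Cons.IH[OF c\<phi>]
        by (simp add: Dtot_Cons[OF z, of j "\<theta> \<and>\<^sub>w \<phi>"] l wedge_Cons \<theta> D\<theta> Dt wedge_add algebra_simps)
          (simp add: t_def)
    qed
  qed
qed

section \<open>Contact monomials\<close>

lemma dcoord_apply [simp]: "dcoord c z [v] = v c"
  by (simp add: dcoord_def)

lemma one_form_dcoord: "one_form (dcoord c)"
  by (simp add: one_form_def dcoord_def)

lemma null_vec_dcoord: "null_vec (dcoord c)"
  unfolding null_vec_def dcoord_def by (auto simp: Suc_length_conv Cons_eq_append_conv length_Suc_conv)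

lemma smooth_form_dcoord: "smooth_form W (dcoord c)"
  by (simp add: smooth_form_def dcoord_def jsmooth_const)

lemma theta_apply:
  "theta \<alpha> I z vs = (if length vs = 1
     then hd vs (Fib \<alpha> I) - (\<Sum>j\<in>UNIV. z (Fib \<alpha> (add_mset j I)) * hd vs (Base j)) else 0)"
  by (simp add: theta_def sum_form_apply smul_apply dcoord_def)

lemma one_form_theta: "one_form (theta \<alpha> I)"
  by (simp add: one_form_def theta_apply)

lemma null_vec_theta: "null_vec (theta \<alpha> I)"
  unfolding null_vec_def
proof (intro allI)
  fix z and us vs :: "('a, 'b) tangent list"
  show "theta \<alpha> I z (us @ (\<lambda>_. 0) # vs) = 0"
    by (cases us) (simp_all add: theta_apply)
qed

fun fib_vec :: "'m \<times> 'n multiset \<Rightarrow> ('n, 'm) tangent" where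
  "fib_vec (\<alpha>, I) = coord_vec (Fib \<alpha> I)"

lemma theta_fib_vec: "theta \<alpha> I z [fib_vec k] = of_bool ((\<alpha>, I) = k)"
  by (cases k) (simp add: theta_apply coord_vec_def)

text \<open>
  The bracket with a total derivative strips one index from a fibre coordinate vector.  In particular it
  annihilates the vectors dual to the undifferentiated contact forms.
\<close>

lemma shift_fib_vec:
  "shift j (fib_vec (\<alpha>, I)) = (if j \<in># I then fib_vec (\<alpha>, I - {#j#}) else (\<lambda>_. 0))"
proof
  fix c show "shift j (fib_vec (\<alpha>, I)) c = (if j \<in># I then fib_vec (\<alpha>, I - {#j#}) else (\<lambda>_. 0)) c"
    by (cases c) (auto simp: shift_def coord_vec_def, metis union_single_eq_member)
qed

lemma shift_coord_vec_Base: "shift j (coord_vec (Base i)) = (\<lambda>_. 0)"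
proof
  fix c show "shift j (coord_vec (Base i)) c = 0"
    by (cases c) (auto simp: shift_def coord_vec_def)
qed

definition basis_form :: "'n list \<Rightarrow> ('n, 'm) form" where
  "basis_form xs = foldr (\<lambda>i \<phi>. dcoord (Base i) \<and>\<^sub>w \<phi>) xs (zero_form (\<lambda>_. 1))"

lemma basis_form_Nil: "basis_form [] = zero_form (\<lambda>_. 1)"
  and basis_form_Cons: "basis_form (i # xs) = (dcoord (Base i) \<and>\<^sub>w basis_form xs)"
  by (simp_all add: basis_form_def)

lemma vol_eq: "vol \<rho> = smul (\<lambda>z. \<rho> (base_pt z)) (basis_form (sorted_list_of_set UNIV))"
  by (simp add: vol_def basis_form_def)

lemma alternating_basis_form: "alternating (basis_form xs)"
proof (induction xs)
  case Nil
  then show ?case by (simp add: basis_form_Nil alternating_def zero_form_def)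
qed (simp add: basis_form_Cons alternating_wedge one_form_dcoord)

lemma null_vec_basis_form: "null_vec (basis_form xs)"
proof (induction xs)
  case Nil
  then show ?case by (simp add: basis_form_Nil null_vec_def zero_form_def)
qed (simp add: basis_form_Cons null_vec_wedge one_form_dcoord null_vec_dcoord)

lemma smooth_form_basis_form: "open W \<Longrightarrow> smooth_form W (basis_form xs)"
proof (induction xs)
  case Nil
  have "(\<lambda>z. zero_form (\<lambda>_. 1) z vs) = (\<lambda>_. if vs = [] then 1 else 0)"
    for vs :: "('a, 'b) tangent list"
    by (simp add: zero_form_def)
  then show ?case
    by (simp add: basis_form_Nil smooth_form_def jsmooth_const)
qed (simp add: basis_form_Cons smooth_form_wedge smooth_form_dcoord)

lemma contract_basis_form:
  assumes "\<And>i. i \<in> set xs \<Longrightarrow> v (Base i) = 0"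
  shows "basis_form xs z (v # vs) = 0"
  using assms
proof (induction xs arbitrary: vs)
  case Nil
  then show ?case by (simp add: basis_form_Nil zero_form_def)
next
  case (Cons i xs)
  have "(dcoord (Base i) \<and>\<^sub>w contract v (basis_form xs)) z vs = (dcoord (Base i) \<and>\<^sub>w 0) z vs"
    by (rule wedge_cong) (simp_all add: contract_apply Cons)
  then have "(dcoord (Base i) \<and>\<^sub>w contract v (basis_form xs)) z vs = 0" by simp
  then show ?case
    using Cons.prems by (simp add: basis_form_Cons wedge_Cons[OF one_form_dcoord])
qed

lemma basis_form_basis:
  "distinct xs \<Longrightarrow> basis_form xs z (map (\<lambda>i. coord_vec (Base i)) xs) = 1"
proof (induction xs)
  case Nil
  then show ?case by (simp add: basis_form_Nil zero_form_def)
next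
  case (Cons i xs)
  have "(dcoord (Base i) \<and>\<^sub>w contract (coord_vec (Base i)) (basis_form xs)) z vs
      = (dcoord (Base i) \<and>\<^sub>w 0) z vs" for vs
    using Cons.prems
    by (intro wedge_cong) (auto simp: contract_apply coord_vec_def intro!: contract_basis_form)
  then have "(dcoord (Base i) \<and>\<^sub>w contract (coord_vec (Base i)) (basis_form xs)) z vs = 0" for vs
    by simp
  then show ?case
    using Cons by (simp add: basis_form_Cons wedge_Cons[OF one_form_dcoord])
      (simp add: coord_vec_def)
qed

lemma Dtot_basis_form:
  assumes "open W" "z \<in> jets W"
  shows "Dtot W j (basis_form xs) z vs = 0"
proof (induction xs arbitrary: vs)
  case Nil
  have *: "(\<lambda>y. zero_form (\<lambda>_. 1) y vs) = (\<lambda>_. if vs = [] then 1 else 0)"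
    by (simp add: zero_form_def)
  show ?case
    unfolding basis_form_Nil Dtot_apply[OF assms(2)] * by (simp add: zero_form_def)
next
  case (Cons i xs)
  have D: "Dtot W j (dcoord (Base i)) z us = 0" for us
  proof (cases "length us = 1")
    case True
    then obtain v where "us = [v]" by (cases us) auto
    then show ?thesis by (simp add: Dtot_apply[OF assms(2)] shift_def)
  next
    case False
    then show ?thesis
      using one_form_Dtot[OF one_form_dcoord, of W j "Base i"] by (simp add: one_form_def)
  qed
  have "(Dtot W j (dcoord (Base i)) \<and>\<^sub>w basis_form xs) z vs = 0"
    by (simp add: wedge_def D)
  moreover have "(dcoord (Base i) \<and>\<^sub>w Dtot W j (basis_form xs)) z vs = 0"
    by (simp add: wedge_def Cons)
  ultimately show ?case
    unfolding basis_form_Cons Dtot_wedge[OF assms(1) one_form_dcoord smooth_form_dcoord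
        smooth_form_basis_form[OF assms(1)]]
    by simp
qed

lemma monomial_Nil: "monomial \<rho> [] = vol \<rho>"
  and monomial_Cons: "monomial \<rho> ((\<alpha>, I) # js) = (theta \<alpha> I \<and>\<^sub>w monomial \<rho> js)"
  by (simp_all add: monomial_def)

lemma alternating_smul:
  assumes "alternating \<phi>"
  shows "alternating (smul f \<phi>)"
  unfolding alternating_def smul_apply
proof (intro allI)
  fix z us a b vs
  show "f z * \<phi> z (us @ a # b # vs) = - (f z * \<phi> z (us @ b # a # vs))"
    using alternatingD[OF assms, of z us a b vs] by simp
qed

lemma null_vec_smul: "null_vec \<phi> \<Longrightarrow> null_vec (smul f \<phi>)"
  by (simp add: null_vec_def smul_apply)

lemma alternating_monomial: "alternating (monomial \<rho> js)"
proof (induction js)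
  case Nil
  show ?case by (simp add: monomial_Nil vol_eq alternating_smul alternating_basis_form)
next
  case (Cons k js)
  then show ?case
    by (cases k) (simp add: monomial_Cons alternating_wedge one_form_theta)
qed

lemma null_vec_monomial: "null_vec (monomial \<rho> js)"
proof (induction js)
  case Nil
  show ?case by (simp add: monomial_Nil vol_eq null_vec_smul null_vec_basis_form)
next
  case (Cons k js)
  then show ?case
    by (cases k) (simp add: monomial_Cons null_vec_wedge one_form_theta null_vec_theta)
qed

text \<open>
  Contact forms are dual to the fibre coordinate vectors, which in turn annihilate the volume form.
  Contraction therefore deletes the matching factors one at a time.
\<close>

lemma contract_monomial:
  "contract (fib_vec k) (monomial \<rho> js) =
    (\<Sum>r<length js. smul (\<lambda>_. (-1) ^ r * of_bool (js ! r = k)) (monomial \<rho> (del r js)))"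
proof (induction js)
  case Nil
  have "fib_vec k (Base i) = 0" for i
    by (cases k) (simp add: coord_vec_def)
  then show ?case
    by (intro ext) (simp add: monomial_Nil vol_eq contract_apply smul_apply contract_basis_form)
next
  case (Cons l js)
  obtain \<alpha> I where l: "l = (\<alpha>, I)" by (cases l)
  have "contract (fib_vec k) (monomial \<rho> (l # js)) =
      smul (\<lambda>_. of_bool (l = k)) (monomial \<rho> js) -
      (\<Sum>r<length js. smul (\<lambda>_. (-1) ^ r * of_bool (js ! r = k)) (monomial \<rho> (l # del r js)))"
    unfolding l monomial_Cons contract_wedge[OF one_form_theta] theta_fib_vec Cons wedge_sum wedge_smul ..
  also have "\<dots> = (\<Sum>r<length (l # js).
      smul (\<lambda>_. (-1) ^ r * of_bool ((l # js) ! r = k)) (monomial \<rho> (del r (l # js))))"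
    by (intro ext) (simp add: sum_form_apply smul_apply sum.lessThan_Suc_shift sum_negf
        del: sum.lessThan_Suc)
  finally show ?case .
qed

lemma contract_monomial_apply:
  "monomial \<rho> js z (fib_vec k # vs) =
    (\<Sum>r<length js. (-1) ^ r * of_bool (js ! r = k) * monomial \<rho> (del r js) z vs)"
proof -
  have "monomial \<rho> js z (fib_vec k # vs) = contract (fib_vec k) (monomial \<rho> js) z vs"
    by (simp add: contract_apply)
  then show ?thesis
    by (simp add: contract_monomial sum_form_apply smul_apply)
qed

abbreviation weight :: "('m \<times> 'n multiset) list \<Rightarrow> nat" where
  "weight js \<equiv> (\<Sum>(\<alpha>, I)\<leftarrow>js. size I)"

lemma weight_del: "r < length js \<Longrightarrow> weight js = size (snd (js ! r)) + weight (del r js)"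
proof (induction js arbitrary: r)
  case (Cons k js)
  then show ?case by (cases r) (auto simp: case_prod_beta)
qed simp

text \<open>
  Every fibre coordinate vector has to be absorbed by a contact factor with the same multi-index, so
  neither the number nor the total order of the vectors can exceed that of the factors.
\<close>

lemma monomial_excess:
  "length js < length ks \<or> weight js < weight ks \<Longrightarrow> monomial \<rho> js z (map fib_vec ks @ vs) = 0"
proof (induction ks arbitrary: js)
  case (Cons k ks)
  have "of_bool (js ! r = k) * monomial \<rho> (del r js) z (map fib_vec ks @ vs) = 0"
    if "r < length js" for r
  proof (cases "js ! r = k")
    case True
    have "length (del r js) < length ks \<or> weight (del r js) < weight ks"
      using Cons.prems weight_del[OF that] True that by (cases k) (auto simp: length_del)
    then show ?thesis by (simp add: Cons.IH)
  qed simp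
  then show ?case
    by (simp add: contract_monomial_apply mult.assoc) (intro sum.neutral, simp)
qed simp

lemma monomial_swap:
  "monomial \<rho> (ks @ k # l # js) = - monomial \<rho> (ks @ l # k # js)"
proof (induction ks)
  case Nil
  obtain \<alpha> I \<beta> J where "k = (\<alpha>, I)" "l = (\<beta>, J)" by (cases k, cases l)
  then show ?case
    by (simp only: append_Nil monomial_Cons wedge_anticommute[OF one_form_theta one_form_theta, of \<alpha> I \<beta> J])
next
  case (Cons m ks)
  obtain \<alpha> I where "m = (\<alpha>, I)" by (cases m)
  then show ?case
    by (simp only: append_Cons monomial_Cons Cons wedge_minus)
qed

locale adapted_chart =
  fixes W :: "('n::{finite,linorder}, 'm::finite) chart" and \<rho> :: "(real, 'n) vec \<Rightarrow> real"
  assumes open_W: "open W" and density: "volume_density W \<rho>"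
begin

lemmas coord_open_jets = jets_coord_open[OF open_W]

lemma density_nonzero: "z \<in> jets W \<Longrightarrow> \<rho> (base_pt z) \<noteq> 0"
  using density by (force simp: volume_density_def jets_def)

lemma density_smooth: "jsmooth (jets W) (\<lambda>z. \<rho> (base_pt z))"
  using density by (simp add: volume_density_def)

lemma smooth_form_theta: "smooth_form W (theta \<alpha> I)"
proof -
  have "jsmooth (jets W) (\<lambda>z. hd vs (Fib \<alpha> I) +
      (\<Sum>j\<in>UNIV. z (Fib \<alpha> (add_mset j I)) * - hd vs (Base j)))" for vs
    by (intro jsmooth_add jsmooth_sum jsmooth_mult jsmooth_const jsmooth_coord coord_open_jets)
  then have "jsmooth (jets W) (\<lambda>z. theta \<alpha> I z vs)" for vs
    by (cases "length vs = 1") (simp_all add: theta_apply sum_negf jsmooth_const)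
  then show ?thesis
    unfolding smooth_form_def by blast
qed

lemma smooth_form_monomial: "smooth_form W (monomial \<rho> js)"
proof (induction js)
  case Nil
  show ?case
    by (simp add: monomial_Nil vol_eq smooth_form_smul smooth_form_basis_form open_W density_smooth)
next
  case (Cons k js)
  then show ?case
    by (cases k) (simp add: monomial_Cons smooth_form_wedge open_W smooth_form_theta)
qed

text \<open>
  Differentiating the coefficients of \<open>theta \<alpha> I\<close> prolongs them, and the bracket term turns the
  differential of a coordinate into that of the prolonged one.
\<close>

lemma Dtot_theta:
  assumes z: "z \<in> jets W"
  shows "Dtot W j (theta \<alpha> I) z vs = theta \<alpha> (add_mset j I) z vs"
proof (cases "length vs = 1")
  case False
  then show ?thesis
    using one_form_Dtot[OF one_form_theta, of W j \<alpha> I] one_form_theta[of \<alpha> "add_mset j I"]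
    by (simp add: one_form_def)
next
  case True
  then obtain v where vs: "vs = [v]" by (cases vs) auto
  define g where "g k y = y (Fib \<alpha> (add_mset k I)) * - v (Base k)" for k and y :: "('n, 'm) jet"
  have g: "jsmooth (jets W) (g k)" for k
    unfolding g_def by (intro jsmooth_mult jsmooth_const jsmooth_coord coord_open_jets)
  have dg: "dird X (g k) z = X (Fib \<alpha> (add_mset k I)) * - v (Base k)" for X k
    using dird_mult[OF jsmooth_coord[of _ "Fib \<alpha> (add_mset k I)"]
        jsmooth_const[of _ "- v (Base k)"] z, of X]
    by (simp add: dird_coord g_def[abs_def])
  have sum: "dird X (\<lambda>y. \<Sum>k\<in>T. g k y) z = (\<Sum>k\<in>T. dird X (g k) z)" for X and T :: "'n set"
  proof (induction T rule: infinite_finite_induct)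
    case (insert k T)
    have "dird X (\<lambda>y. g k y + (\<Sum>k\<in>T. g k y)) z = dird X (g k) z + dird X (\<lambda>y. \<Sum>k\<in>T. g k y) z"
      by (rule dird_add[OF g jsmooth_sum[OF coord_open_jets g] z])
    then show ?case using insert by simp
  qed simp_all
  have theta: "theta \<alpha> I y vs = v (Fib \<alpha> I) + (\<Sum>k\<in>UNIV. g k y)" for y
    by (simp add: theta_apply vs g_def sum_negf)
  have "dird X (\<lambda>y. theta \<alpha> I y vs) z = (\<Sum>k\<in>UNIV. X (Fib \<alpha> (add_mset k I)) * - v (Base k))" for X
    unfolding theta dird_add[OF jsmooth_const jsmooth_sum[OF coord_open_jets g] z] sum dg by simp
  then show ?thesis
    by (simp add: Dtot_apply[OF z] vs theta_apply shift_def add_mset_commute sum_negf)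
qed

text \<open>
  The factor by which the total derivative multiplies the volume form.  It is smooth because the density
  has no zeros on the chart, so that differentiating the volume form stays within the span.
\<close>

definition log_derivative :: "'n \<Rightarrow> ('n, 'm) jet \<Rightarrow> real" where
  "log_derivative j z = dird (total_vf j z) (\<lambda>z. \<rho> (base_pt z)) z * inverse (\<rho> (base_pt z))"

lemma log_derivative_smooth: "jsmooth (jets W) (log_derivative j)"
  unfolding log_derivative_def
  by (intro jsmooth_mult jsmooth_dird jsmooth_inverse density_smooth open_W coord_open_jets
      jsmooth_total_vf density_nonzero)

lemma Dtot_vol:
  "z \<in> jets W \<Longrightarrow> Dtot W j (vol \<rho>) z vs = log_derivative j z * vol \<rho> z vs"
  unfolding vol_eq Dtot_smul[OF density_smooth smooth_form_basis_form[OF open_W]]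
  by (simp add: Dtot_basis_form[OF open_W] smul_apply log_derivative_def density_nonzero)

end

section \<open>Alternating functions of index lists\<close>

text \<open>
  Transpositions of neighbours suffice; arbitrary ones follow in \<open>antisym_list_swap\<close>.
\<close>

definition antisym_list :: "('a list \<Rightarrow> real) \<Rightarrow> bool" where
  "antisym_list M \<longleftrightarrow> (\<forall>us a b vs. M (us @ a # b # vs) = - M (us @ b # a # vs))"

lemma antisym_listD: "antisym_list M \<Longrightarrow> M (us @ a # b # vs) = - M (us @ b # a # vs)"
  unfolding antisym_list_def by blast

lemma antisym_list_Cons: "antisym_list M \<Longrightarrow> antisym_list (\<lambda>xs. M (a # xs))"
  unfolding antisym_list_def by (metis append_Cons)

lemma antisym_list_move:
  assumes "antisym_list M"
  shows "M (ps @ us @ x # ws) = (-1) ^ length us * M (ps @ x # us @ ws)"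
proof (induction us arbitrary: ps)
  case (Cons u us)
  have "M (ps @ (u # us) @ x # ws) = (-1) ^ length us * M (ps @ u # x # us @ ws)"
    using Cons[of "ps @ [u]"] by simp
  also have "M (ps @ u # x # us @ ws) = - M (ps @ x # u # us @ ws)"
    by (rule antisym_listD[OF assms])
  finally show ?case by simp
qed simp

lemma antisym_list_swap:
  assumes "antisym_list M"
  shows "M (ps @ a # us @ b # ws) = - M (ps @ b # us @ a # ws)"
proof -
  have "M (ps @ a # us @ b # ws) = (-1) ^ length us * M ((ps @ [a]) @ b # us @ ws)"
    using antisym_list_move[OF assms, of "ps @ [a]" us b ws] by simp
  also have "M ((ps @ [a]) @ b # us @ ws) = - M (ps @ b # a # us @ ws)"
    using antisym_listD[OF assms, of ps a b "us @ ws"] by simp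
  also have "(-1) ^ length us * - M (ps @ b # a # us @ ws) = - M (ps @ b # us @ a # ws)"
    using antisym_list_move[OF assms, of "ps @ [b]" us a ws] by simp
  finally show ?thesis .
qed

lemma list_update_swap:
  assumes "p < q" "q < length xs"
  obtains us a ms b ws where "xs = us @ a # ms @ b # ws" "length us = p" "length ms = q - Suc p"
    "xs[p := xs ! q, q := xs ! p] = us @ b # ms @ a # ws"
proof -
  define us ms ws where "us = take p xs" and "ms = take (q - Suc p) (drop (Suc p) xs)"
    and "ws = drop (Suc q) xs"
  have l: "length us = p" "length ms = q - Suc p"
    using assms by (simp_all add: us_def ms_def)
  have "drop (Suc p) xs = ms @ xs ! q # ws"
    using assms id_take_nth_drop[of "q - Suc p" "drop (Suc p) xs"] by (simp add: ms_def ws_def)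
  then have xs: "xs = us @ xs ! p # ms @ xs ! q # ws"
    using assms id_take_nth_drop[of p xs] by (simp add: us_def)
  have q: "q = p + Suc (length ms)" using assms l by simp
  have "(us @ xs ! p # ms @ xs ! q # ws)[p := b, q := a] = us @ b # ms @ a # ws" for a b
    unfolding q by (simp add: list_update_append l(1)[symmetric] del: l(1))
  then have "xs[p := xs ! q, q := xs ! p] = us @ xs ! q # ms @ xs ! p # ws"
    using xs by metis
  then show thesis using that xs l by blast
qed

abbreviation lists_of :: "nat \<Rightarrow> 'a list set" where
  "lists_of k \<equiv> {xs. length xs = k}"

lemma finite_lists_of: "finite (lists_of k :: 'a::finite list set)"
  using finite_lists_length_eq[of "UNIV :: 'a set" k] by simp

lemma sum_lists_Cons:
  fixes f :: "'a::finite list \<Rightarrow> 'b::comm_monoid_add"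
  shows "(\<Sum>xs\<in>lists_of (Suc k). f xs) = (\<Sum>a\<in>UNIV. \<Sum>xs\<in>lists_of k. f (a # xs))"
  unfolding sum.cartesian_product
  by (rule sum.reindex_bij_witness[where i = "\<lambda>(a, xs). a # xs" and j = "\<lambda>xs. (hd xs, tl xs)"])
    (auto simp: length_Suc_conv)

lemma sum_lists_snoc:
  fixes f :: "'a::finite list \<Rightarrow> 'b::comm_monoid_add"
  shows "(\<Sum>xs\<in>lists_of (Suc k). f xs) = (\<Sum>xs\<in>lists_of k. \<Sum>a\<in>UNIV. f (xs @ [a]))"
  unfolding sum.cartesian_product
  by (rule sum.reindex_bij_witness[where i = "\<lambda>(xs, a). xs @ [a]" and j = "\<lambda>xs. (butlast xs, last xs)"])
    (auto intro!: append_butlast_last_id arg_cong[of _ _ f])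

text \<open>
  The determinant of the Kronecker matrix with rows \<open>js\<close> and columns \<open>ks\<close>, expanded along the first
  column.  It is the coefficient pairing between contact monomials and lists of coordinate vectors.
\<close>

fun kdet :: "'a list \<Rightarrow> 'a list \<Rightarrow> real" where
  "kdet js [] = of_bool (js = [])"
| "kdet js (k # ks) = (\<Sum>r<length js. (-1) ^ r * of_bool (js ! r = k) * kdet (del r js) ks)"

text \<open>
  Antisymmetrizing an alternating function multiplies it by a factorial.  After expanding the determinant
  along the first column, the term of row \<open>r\<close> carries the sign that moves the entry \<open>r\<close> to the front, so
  all rows contribute equally.
\<close>

lemma sum_kdet_columns:
  fixes M :: "'a::finite list \<Rightarrow> real"
  assumes "antisym_list M"
  shows "(\<Sum>ks\<in>lists_of (length js). kdet js ks * M ks) = fact (length js) * M js"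
  using assms
proof (induction "length js" arbitrary: js M)
  case 0
  have "lists_of 0 = {[] :: 'a list}" by auto
  with 0 show ?case by simp
next
  case (Suc n)
  have step: "(-1) ^ r * (\<Sum>ks\<in>lists_of n. kdet (del r js) ks * M (js ! r # ks)) = fact n * M js"
    if "r < length js" for r
  proof -
    have n: "n = length (del r js)" using that Suc.hyps(2) by (simp add: length_del)
    have "M js = (-1) ^ r * M (js ! r # del r js)"
      using antisym_list_move[OF Suc.prems, of "[]" "take r js" "js ! r" "drop (Suc r) js"] that
      by (simp add: del_def id_take_nth_drop[symmetric])
    then show ?thesis
      using Suc.hyps(1)[OF n antisym_list_Cons[OF Suc.prems, of "js ! r"]] n
      by (simp flip: power_add mult_2)
  qed
  have "(\<Sum>ks\<in>lists_of (length js). kdet js ks * M ks) =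
      (\<Sum>k\<in>UNIV. \<Sum>ks\<in>lists_of n. \<Sum>r<length js.
        of_bool (js ! r = k) * ((-1) ^ r * (kdet (del r js) ks * M (k # ks))))"
    unfolding Suc.hyps(2)[symmetric] sum_lists_Cons
    by (simp add: Suc.hyps(2) sum_distrib_left sum_distrib_right mult_ac del: sum.lessThan_Suc)
  also have "\<dots> = (\<Sum>r<length js. \<Sum>k\<in>UNIV. of_bool (js ! r = k) *
      ((-1) ^ r * (\<Sum>ks\<in>lists_of n. kdet (del r js) ks * M (k # ks))))"
    unfolding sum_distrib_left
    by (subst sum.swap[of _ _ "lists_of n"]) (simp add: sum.swap[of _ UNIV])
  also have "\<dots> = (\<Sum>r<length js. (-1) ^ r * (\<Sum>ks\<in>lists_of n. kdet (del r js) ks * M (js ! r # ks)))"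
    by (simp add: of_bool_def if_distrib[of "\<lambda>x. x * _"] cong: if_cong)
  also have "\<dots> = (\<Sum>r<length js. fact n * M js)"
    by (intro sum.cong refl step) simp
  finally show ?case
    unfolding Suc.hyps(2)[symmetric] by (simp add: algebra_simps)
qed

lemma sum_lists_insert:
  fixes f :: "'a::finite list \<Rightarrow> real"
  assumes "r < Suc n"
  shows "(\<Sum>js\<in>lists_of (Suc n). of_bool (js ! r = k) * f js) =
    (\<Sum>js\<in>lists_of n. f (take r js @ k # drop r js))"
proof -
  have "(\<Sum>js\<in>lists_of (Suc n). of_bool (js ! r = k) * f js) =
      (\<Sum>js\<in>{js\<in>lists_of (Suc n). js ! r = k}. of_bool (js ! r = k) * f js)"
    by (rule sum.mono_neutral_right) (auto simp: finite_lists_of)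
  also have "\<dots> = (\<Sum>js\<in>lists_of n. f (take r js @ k # drop r js))"
    using assms
    by (intro sum.reindex_bij_witness[where i = "\<lambda>js. take r js @ k # drop r js" and j = "del r"])
      (auto simp: del_def min_def nth_append id_take_nth_drop[symmetric] Cons_nth_drop_Suc)
  finally show ?thesis .
qed

text \<open>
  The same identity with the roles of rows and columns exchanged.  The expansion along a column now
  restricts the summation variable, which is resolved by reinserting the prescribed entry.
\<close>

lemma sum_kdet_rows:
  fixes M :: "'a::finite list \<Rightarrow> real"
  assumes "antisym_list M"
  shows "(\<Sum>js\<in>lists_of (length ks). M js * kdet js ks) = fact (length ks) * M ks"
  using assms
proof (induction ks arbitrary: M)
  case Nil
  have "lists_of 0 = {[] :: 'a list}" by auto
  then show ?case by simp
next
  case (Cons k ks)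
  let ?n = "length ks"
  have "(\<Sum>js\<in>lists_of (Suc ?n). M js * kdet js (k # ks)) =
      (\<Sum>js\<in>lists_of (Suc ?n). \<Sum>r<Suc ?n.
        of_bool (js ! r = k) * ((-1) ^ r * M js * kdet (del r js) ks))"
    by (intro sum.cong refl) (simp add: sum_distrib_left mult_ac del: sum.lessThan_Suc)
  also have "\<dots> = (\<Sum>r<Suc ?n. \<Sum>js\<in>lists_of ?n.
      (-1) ^ r * M (take r js @ k # drop r js) * kdet (del r (take r js @ k # drop r js)) ks)"
    by (subst sum.swap) (intro sum.cong refl sum_lists_insert, simp)
  also have "\<dots> = (\<Sum>r<Suc ?n. \<Sum>js\<in>lists_of ?n. M (k # js) * kdet js ks)"
  proof (intro sum.cong refl)
    fix r and js :: "'a list" assume "r \<in> {..<Suc ?n}" "js \<in> lists_of ?n"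
    then have r: "r \<le> length js" by auto
    have "M (take r js @ k # drop r js) = (-1) ^ r * M (k # js)"
      using antisym_list_move[OF Cons.prems, of "[]" "take r js" k "drop r js"] r by simp
    moreover have "del r (take r js @ k # drop r js) = js"
      using r by (simp add: del_def)
    ultimately show "(-1) ^ r * M (take r js @ k # drop r js) *
        kdet (del r (take r js @ k # drop r js)) ks = M (k # js) * kdet js ks"
      by (simp flip: power_add mult_2)
  qed
  also have "\<dots> = fact (Suc ?n) * M (k # ks)"
    unfolding Cons.IH[OF antisym_list_Cons[OF Cons.prems]] by (simp add: algebra_simps)
  finally show ?case by simp
qed

section \<open>The filtered module\<close>

text \<open>
  An element is a combination of a finite set of generators, each occurring once, so two families of
  coefficients are extended by zero to the union of the generating sets before they are added.
\<close>

lemma Rspan_add: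
  assumes W: "open W" and "\<omega> \<in> Rspan W B" "\<phi> \<in> Rspan W B"
  shows "\<omega> + \<phi> \<in> Rspan W B"
proof -
  obtain S f where S: "finite S" "S \<subseteq> B" "\<forall>b\<in>S. f b \<in> Rinf W" "\<omega> = (\<Sum>b\<in>S. smul (f b) b)"
    using assms(2) unfolding Rspan_def by blast
  obtain T g where T: "finite T" "T \<subseteq> B" "\<forall>b\<in>T. g b \<in> Rinf W" "\<phi> = (\<Sum>b\<in>T. smul (g b) b)"
    using assms(3) unfolding Rspan_def by blast
  define F where "F b z = (if b \<in> S then f b z else 0)" for b z
  define G where "G b z = (if b \<in> T then g b z else 0)" for b z
  have F: "F b \<in> Rinf W" for b
    using S(3) Rinf_zero[of W] by (cases "b \<in> S") (simp_all add: F_def[abs_def])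
  have G: "G b \<in> Rinf W" for b
    using T(3) Rinf_zero[of W] by (cases "b \<in> T") (simp_all add: G_def[abs_def])
  have "\<omega> = (\<Sum>b\<in>S \<union> T. smul (F b) b)"
    unfolding S(4) using S(1) T(1)
    by (intro sum.mono_neutral_cong_left) (auto simp: F_def smul_def fun_eq_iff)
  moreover have "\<phi> = (\<Sum>b\<in>S \<union> T. smul (G b) b)"
    unfolding T(4) using S(1) T(1)
    by (intro sum.mono_neutral_cong_left) (auto simp: G_def smul_def fun_eq_iff)
  ultimately have "\<omega> + \<phi> = (\<Sum>b\<in>S \<union> T. smul (\<lambda>z. F b z + G b z) b)"
    by (intro ext) (simp add: sum_form_apply smul_apply algebra_simps sum.distrib)
  then show ?thesis
    unfolding Rspan_def using S(1,2) T(1,2) Rinf_add[OF W F G]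
    by (intro CollectI exI[of _ "S \<union> T"] exI[of _ "\<lambda>b z. F b z + G b z"]) simp
qed

lemma Rspan_zero: "0 \<in> Rspan W B"
  unfolding Rspan_def by (rule CollectI, rule exI[of _ "{}"]) simp

lemma Rspan_generator:
  assumes "f \<in> Rinf W" "b \<in> B"
  shows "smul f b \<in> Rspan W B"
  unfolding Rspan_def
  by (rule CollectI, rule exI[of _ "{b}"], rule exI[of _ "\<lambda>_. f"]) (simp add: assms)

lemma Rspan_induct [consumes 2, case_names zero add generator]:
  assumes W: "open W" and "\<omega> \<in> Rspan W B" and "P 0"
    and add: "\<And>\<omega> \<phi>. \<omega> \<in> Rspan W B \<Longrightarrow> \<phi> \<in> Rspan W B \<Longrightarrow> P \<omega> \<Longrightarrow> P \<phi> \<Longrightarrow> P (\<omega> + \<phi>)"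
    and gen: "\<And>f b. f \<in> Rinf W \<Longrightarrow> b \<in> B \<Longrightarrow> P (smul f b)"
  shows "P \<omega>"
proof -
  obtain S f where S: "finite S" "S \<subseteq> B" "\<forall>b\<in>S. f b \<in> Rinf W" "\<omega> = (\<Sum>b\<in>S. smul (f b) b)"
    using assms(2) unfolding Rspan_def by blast
  have "(\<Sum>b\<in>S. smul (f b) b) \<in> Rspan W B \<and> P (\<Sum>b\<in>S. smul (f b) b)"
    using S(1-3)
  proof (induction S)
    case empty
    show ?case
      unfolding sum.empty by (intro conjI Rspan_zero \<open>P 0\<close>)
  next
    case (insert b S)
    then have b: "f b \<in> Rinf W" "b \<in> B" by auto
    have S: "(\<Sum>b\<in>S. smul (f b) b) \<in> Rspan W B" "P (\<Sum>b\<in>S. smul (f b) b)"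
      using insert by auto
    show ?case
      unfolding sum.insert[OF insert(1,2)]
      by (intro conjI Rspan_add[OF W] add Rspan_generator gen b S)
  qed
  then show ?thesis unfolding S(4) by blast
qed

lemma weight_one_cases:
  assumes "weight js = 1"
  obtains \<beta>s \<gamma> i \<beta>s' where
    "js = map (\<lambda>\<alpha>. (\<alpha>, {#})) \<beta>s @ (\<gamma>, {#i#}) # map (\<lambda>\<alpha>. (\<alpha>, {#})) \<beta>s'"
proof -
  have flat: "\<exists>\<beta>s. js = map (\<lambda>\<alpha>. (\<alpha>, {#})) \<beta>s" if "weight js = 0" for js :: "('a \<times> 'b multiset) list"
    using that
  proof (induction js)
    case (Cons k js)
    then obtain \<beta>s where "js = map (\<lambda>\<alpha>. (\<alpha>, {#})) \<beta>s" by (cases k) auto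
    with Cons.prems show ?case
      by (intro exI[of _ "fst k # \<beta>s"], cases k) simp
  qed simp
  have "\<exists>\<beta>s \<gamma> i \<beta>s'. js = map (\<lambda>\<alpha>. (\<alpha>, {#})) \<beta>s @ (\<gamma>, {#i#}) # map (\<lambda>\<alpha>. (\<alpha>, {#})) \<beta>s'"
    using assms
  proof (induction js)
    case (Cons k js)
    obtain \<alpha> I where k: "k = (\<alpha>, I)" by (cases k)
    show ?case
    proof (cases "I = {#}")
      case True
      then obtain \<beta>s \<gamma> i \<beta>s' where
        "js = map (\<lambda>\<alpha>. (\<alpha>, {#})) \<beta>s @ (\<gamma>, {#i#}) # map (\<lambda>\<alpha>. (\<alpha>, {#})) \<beta>s'"
        using Cons k by auto
      then show ?thesis
        using k True by (intro exI[of _ "\<alpha> # \<beta>s"] exI[of _ \<gamma>] exI[of _ i] exI[of _ \<beta>s']) simp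
    next
      case False
      then have "size I \<noteq> 0" by simp
      moreover have "size I + weight js = 1" using Cons.prems k by simp
      ultimately have I: "size I = 1" "weight js = 0" by linarith+
      obtain i where "I = {#i#}" using size_1_singleton_mset[OF I(1)] by blast
      moreover obtain \<beta>s where "js = map (\<lambda>\<alpha>. (\<alpha>, {#})) \<beta>s" using flat[OF I(2)] by blast
      ultimately show ?thesis
        using k by (intro exI[of _ "[]"] exI[of _ \<alpha>] exI[of _ i] exI[of _ \<beta>s]) simp
    qed
  qed simp
  then show thesis using that by blast
qed

lemma antisym_list_monomial: "antisym_list (\<lambda>js. monomial \<rho> js z vs)"
  unfolding antisym_list_def
proof (intro allI)
  fix us a b js
  show "monomial \<rho> (us @ a # b # js) z vs = - monomial \<rho> (us @ b # a # js) z vs"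
    unfolding monomial_swap[of \<rho> us a b js] by simp
qed

lemma monomial_eval:
  "length js = length ks \<Longrightarrow> monomial \<rho> js z (map fib_vec ks @ vs) = kdet js ks * vol \<rho> z vs"
proof (induction ks arbitrary: js)
  case (Cons k ks)
  have "monomial \<rho> (del r js) z (map fib_vec ks @ vs) = kdet (del r js) ks * vol \<rho> z vs"
    if "r < length js" for r
    using Cons.prems that by (intro Cons.IH) (simp add: length_del)
  then show ?case
    by (simp add: contract_monomial_apply sum_distrib_right mult.assoc del: sum.lessThan_Suc)
qed (simp add: monomial_Nil)

text \<open>
  The factors in the general term of \<open>eta\<close>: all of order zero except for the last one.
\<close>

definition slots :: "'n \<Rightarrow> 'm list \<Rightarrow> ('m \<times> 'n multiset) list" where
  "slots i \<alpha>s = map (\<lambda>\<alpha>. (\<alpha>, {#})) (butlast \<alpha>s) @ [(last \<alpha>s, {#i#})]"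

lemma slots_snoc: "slots i (\<alpha>s @ [\<alpha>]) = map (\<lambda>\<alpha>. (\<alpha>, {#})) \<alpha>s @ [(\<alpha>, {#i#})]"
  by (simp add: slots_def)

lemma length_slots: "\<alpha>s \<noteq> [] \<Longrightarrow> length (slots i \<alpha>s) = length \<alpha>s"
  by (simp add: slots_def)

lemma weight_map_empty: "weight (map (\<lambda>\<alpha>. (\<alpha>, {#})) \<alpha>s) = 0"
  by (induction \<alpha>s) simp_all

lemma weight_slots: "weight (slots i \<alpha>s) = 1"
  using weight_map_empty by (simp add: slots_def del: map_map)

text \<open>
  The factor of order one only pairs with the vector of order one, so the determinant splits.
\<close>

lemma kdet_slots:
  "length \<beta>s = length \<alpha>s \<Longrightarrow>
    kdet (slots i (\<beta>s @ [\<beta>])) (slots j (\<alpha>s @ [\<alpha>])) = kdet \<beta>s \<alpha>s * of_bool (\<beta> = \<alpha> \<and> i = j)"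
proof (induction \<alpha>s arbitrary: \<beta>s)
  case Nil
  then show ?case by (simp add: slots_def)
next
  case (Cons a \<alpha>s)
  let ?js = "slots i (\<beta>s @ [\<beta>])"
  have l: "length ?js = Suc (length \<beta>s)" by (simp add: length_slots)
  have t: "of_bool (?js ! r = (a, {#})) * kdet (del r ?js) (slots j (\<alpha>s @ [\<alpha>])) =
      of_bool (\<beta>s ! r = a) * kdet (del r \<beta>s) \<alpha>s * of_bool (\<beta> = \<alpha> \<and> i = j)"
    if r: "r < length \<beta>s" for r
  proof -
    have "?js ! r = (\<beta>s ! r, {#})" using r by (simp add: slots_snoc nth_append)
    moreover have "del r ?js = slots i (del r \<beta>s @ [\<beta>])"
      using r slots_snoc[of i "del r \<beta>s" \<beta>]
      by (simp add: slots_snoc[of i \<beta>s] del_def take_map drop_map)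
    ultimately show ?thesis
      using Cons r by (simp add: length_del)
  qed
  have c: "slots j ((a # \<alpha>s) @ [\<alpha>]) = (a, {#}) # slots j (\<alpha>s @ [\<alpha>])"
    by (simp add: slots_def)
  have 0: "of_bool (?js ! length \<beta>s = (a, {#})) = (0 :: real)"
    by (simp add: slots_snoc nth_append)
  have "kdet ?js (slots j ((a # \<alpha>s) @ [\<alpha>])) =
      (\<Sum>r<length ?js. (-1) ^ r * (of_bool (?js ! r = (a, {#})) * kdet (del r ?js) (slots j (\<alpha>s @ [\<alpha>]))))"
    unfolding c by (simp add: mult.assoc del: sum.lessThan_Suc)
  also have "\<dots> = (\<Sum>r<length \<beta>s. (-1) ^ r * (of_bool (\<beta>s ! r = a) * kdet (del r \<beta>s) \<alpha>s
      * of_bool (\<beta> = \<alpha> \<and> i = j)))"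
    unfolding l by (simp add: 0 t)
  also have "\<dots> = kdet \<beta>s (a # \<alpha>s) * of_bool (\<beta> = \<alpha> \<and> i = j)"
    by (simp add: sum_distrib_right mult.assoc)
  finally show ?case .
qed

lemma eta_slots:
  "eta \<rho> s A = (\<Sum>i\<in>UNIV. \<Sum>\<alpha>s\<in>lists_of s. smul (A i \<alpha>s) (monomial \<rho> (slots i \<alpha>s)))"
  by (simp add: eta_def slots_def)

lemma eta_apply:
  "eta \<rho> s A z vs = (\<Sum>i\<in>UNIV. \<Sum>\<alpha>s\<in>lists_of s. A i \<alpha>s z * monomial \<rho> (slots i \<alpha>s) z vs)"
  by (simp add: eta_slots sum_form_apply smul_apply)

text \<open>The coordinate vectors of the base, which a volume form takes to its density.\<close>

definition base_vecs :: "('n::{finite,linorder}, 'm) tangent list" where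
  "base_vecs = map (\<lambda>i. coord_vec (Base i)) (sorted_list_of_set UNIV)"

lemma vol_base_vecs: "vol \<rho> z base_vecs = \<rho> (base_pt z)"
  by (simp add: vol_eq smul_apply base_vecs_def basis_form_basis)

text \<open>
  The coefficient of a form in \<open>Fil W \<rho> s 1\<close>, read off by evaluation on coordinate vectors.  Every
  contact factor pairs with every vector of its own kind, hence the factorial.
\<close>

definition contact_coeff ::
  "((real, 'n::{finite,linorder}) vec \<Rightarrow> real) \<Rightarrow> nat \<Rightarrow> ('n, 'm) form \<Rightarrow> ('n, 'm) coeffs" where
  "contact_coeff \<rho> s \<omega> i \<alpha>s z =
    \<omega> z (map fib_vec (slots i \<alpha>s) @ base_vecs) / (fact (s - 1) * \<rho> (base_pt z))"

lemma contact_coeff_add: "contact_coeff \<rho> s (\<omega> + \<phi>) i \<alpha>s z = contact_coeff \<rho> s \<omega> i \<alpha>s z + contact_coeff \<rho> s \<phi> i \<alpha>s z"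
  and contact_coeff_diff: "contact_coeff \<rho> s (\<omega> - \<phi>) i \<alpha>s z = contact_coeff \<rho> s \<omega> i \<alpha>s z - contact_coeff \<rho> s \<phi> i \<alpha>s z"
  by (simp_all add: contact_coeff_def add_divide_distrib diff_divide_distrib)

text \<open>
  Admissibility is silent about lists of other lengths, hence the cut-off.
\<close>

lemma admissible_antisym_list:
  assumes "admissible W s A"
  shows "antisym_list (\<lambda>\<beta>s. if Suc (length \<beta>s) = s then A i (\<beta>s @ [\<gamma>]) z else 0)"
  unfolding antisym_list_def
proof (intro allI)
  fix us a b vs
  let ?\<alpha>s = "us @ a # b # vs @ [\<gamma>]"
  let ?p = "length us"
  have "A i (?\<alpha>s[?p := ?\<alpha>s ! Suc ?p, Suc ?p := ?\<alpha>s ! ?p]) = - A i ?\<alpha>s"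
    if "Suc (length (us @ a # b # vs)) = s"
    using that assms unfolding admissible_def
    by (elim conjE allE[of _ i] allE[of _ ?\<alpha>s] allE[of _ ?p] allE[of _ "Suc ?p"]) auto
  moreover have "?\<alpha>s[?p := ?\<alpha>s ! Suc ?p, Suc ?p := ?\<alpha>s ! ?p] = us @ b # a # vs @ [\<gamma>]"
    by (simp add: list_update_append nth_append)
  ultimately show "(if Suc (length (us @ a # b # vs)) = s then A i ((us @ a # b # vs) @ [\<gamma>]) z else 0) =
      - (if Suc (length (us @ b # a # vs)) = s then A i ((us @ b # a # vs) @ [\<gamma>]) z else 0)"
    by (auto simp: fun_Compl_def)
qed

context adapted_chart
begin

lemma Fil_induct [consumes 1, case_names zero add monomial]:
  assumes "\<omega> \<in> Fil W \<rho> s l" and "P 0"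
    and "\<And>\<omega> \<phi>. \<omega> \<in> Fil W \<rho> s l \<Longrightarrow> \<phi> \<in> Fil W \<rho> s l \<Longrightarrow> P \<omega> \<Longrightarrow> P \<phi> \<Longrightarrow> P (\<omega> + \<phi>)"
    and "\<And>f js. f \<in> Rinf W \<Longrightarrow> length js = s \<Longrightarrow> weight js \<le> l \<Longrightarrow> P (smul f (monomial \<rho> js))"
  shows "P \<omega>"
  using open_W assms(1) unfolding Fil_def
proof (induction rule: Rspan_induct)
  case (generator f b)
  then obtain js where "b = monomial \<rho> js" "length js = s" "weight js \<le> l" by blast
  then show ?case using assms(4) generator(1) by blast
qed (use assms(2,3) in \<open>unfold Fil_def, blast+\<close>)

lemma Fil_monomial:
  "f \<in> Rinf W \<Longrightarrow> length js = s \<Longrightarrow> weight js \<le> l \<Longrightarrow> smul f (monomial \<rho> js) \<in> Fil W \<rho> s l"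
  unfolding Fil_def by (rule Rspan_generator) blast+

lemma Fil_zero: "0 \<in> Fil W \<rho> s l"
  unfolding Fil_def by (rule Rspan_zero)

lemma Fil_add: "\<omega> \<in> Fil W \<rho> s l \<Longrightarrow> \<phi> \<in> Fil W \<rho> s l \<Longrightarrow> \<omega> + \<phi> \<in> Fil W \<rho> s l"
  unfolding Fil_def by (rule Rspan_add[OF open_W])

lemma Fil_sum: "(\<And>i. i \<in> T \<Longrightarrow> F i \<in> Fil W \<rho> s l) \<Longrightarrow> (\<Sum>i\<in>T. F i) \<in> Fil W \<rho> s l"
proof (induction T rule: infinite_finite_induct)
  case (insert i T)
  show ?case
    unfolding sum.insert[OF insert(1,2)] by (intro Fil_add insert.IH insert.prems) simp_all
qed (simp_all only: sum.infinite sum.empty Fil_zero not_False_eq_True)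

lemma Fil_mono:
  assumes "\<omega> \<in> Fil W \<rho> s l" "l \<le> l'"
  shows "\<omega> \<in> Fil W \<rho> s l'"
  using assms(1)
proof (induction rule: Fil_induct)
  case (monomial f js)
  then show ?case using assms(2) by (intro Fil_monomial) auto
qed (rule Fil_zero, rule Fil_add)

lemma Fil_scale:
  assumes "\<omega> \<in> Fil W \<rho> s l"
  shows "smul (\<lambda>_. r) \<omega> \<in> Fil W \<rho> s l"
  using assms
proof (induction rule: Fil_induct)
  case zero
  have "smul (\<lambda>_. r) 0 = (0 :: ('n, 'm) form)" by (intro ext) (simp add: smul_apply)
  then show ?case using Fil_zero by metis
next
  case (add \<omega> \<phi>)
  have "smul (\<lambda>_. r) (\<omega> + \<phi>) = smul (\<lambda>_. r) \<omega> + smul (\<lambda>_. r) \<phi>"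
    by (intro ext) (simp add: smul_apply algebra_simps)
  then show ?case using Fil_add[OF add(3,4)] by metis
next
  case (monomial f js)
  have "smul (\<lambda>_. r) (smul f (monomial \<rho> js)) = smul (\<lambda>z. r * f z) (monomial \<rho> js)"
    by (intro ext) (simp add: smul_apply)
  then show ?case
    using Fil_monomial[OF Rinf_scale[OF open_W monomial(1)] monomial(2,3)] by metis
qed

lemma Fil_minus: "\<omega> \<in> Fil W \<rho> s l \<Longrightarrow> - \<omega> \<in> Fil W \<rho> s l"
  using Fil_scale[of \<omega> s l "-1"] by (simp add: smul_def fun_Compl_def)

lemma Fil_diff: "\<omega> \<in> Fil W \<rho> s l \<Longrightarrow> \<phi> \<in> Fil W \<rho> s l \<Longrightarrow> \<omega> - \<phi> \<in> Fil W \<rho> s l"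
  using Fil_add[OF _ Fil_minus, of \<omega> s l \<phi>] by (simp add: fun_diff_def fun_Compl_def plus_fun_def)

lemma Fil_smooth:
  assumes "\<omega> \<in> Fil W \<rho> s l"
  shows "smooth_form W \<omega>"
  using assms
proof (induction rule: Fil_induct)
  case zero
  show ?case by (simp add: smooth_form_def jsmooth_const)
next
  case (add \<omega> \<phi>)
  then show ?case by (intro smooth_form_add open_W)
next
  case (monomial f js)
  then show ?case
    by (intro smooth_form_smul open_W smooth_form_monomial) (simp add: Rinf_def)
qed

lemma Fil_alternating:
  assumes "\<omega> \<in> Fil W \<rho> s l"
  shows "alternating \<omega>"
  using assms
proof (induction rule: Fil_induct)
  case zero
  show ?case by (simp add: alternating_def)
next
  case (add \<omega> \<phi>)
  show ?case
    unfolding alternating_def plus_fun_apply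
  proof (intro allI)
    fix z us a b vs
    show "\<omega> z (us @ a # b # vs) + \<phi> z (us @ a # b # vs) =
        - (\<omega> z (us @ b # a # vs) + \<phi> z (us @ b # a # vs))"
      using alternatingD[OF add(3), of z us a b vs] alternatingD[OF add(4), of z us a b vs] by simp
  qed
next
  case (monomial f js)
  show ?case by (intro alternating_smul alternating_monomial)
qed

lemma Fil_null_vec:
  assumes "\<omega> \<in> Fil W \<rho> s l"
  shows "null_vec \<omega>"
  using assms
proof (induction rule: Fil_induct)
  case (monomial f js)
  show ?case by (intro null_vec_smul null_vec_monomial)
qed (simp_all add: null_vec_def)

lemma Fil_outside:
  assumes "\<omega> \<in> Fil W \<rho> s l" "z \<notin> jets W"
  shows "\<omega> z vs = 0"
  using assms(1)
proof (induction rule: Fil_induct)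
  case (monomial f js)
  then show ?case using assms(2) by (simp add: smul_apply Rinf_def)
qed simp_all

lemma Fil_excess:
  assumes "\<omega> \<in> Fil W \<rho> s l" "s < length ks \<or> l < weight ks"
  shows "\<omega> z (map fib_vec ks @ vs) = 0"
  using assms(1)
proof (induction rule: Fil_induct)
  case (monomial f js)
  then show ?case using assms(2) by (auto simp: smul_apply intro!: monomial_excess)
qed simp_all

text \<open>
  The last vector has order one and finds no partner among factors of order zero.
\<close>

lemma contact_coeff_Fil_0: "\<omega> \<in> Fil W \<rho> s 0 \<Longrightarrow> contact_coeff \<rho> s \<omega> i \<alpha>s z = 0"
  unfolding contact_coeff_def using Fil_excess[of \<omega> s 0 "slots i \<alpha>s" z base_vecs] weight_slots[of i \<alpha>s]
  by simp

lemma Fil_antisym_list: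
  assumes "\<omega> \<in> Fil W \<rho> s l"
  shows "antisym_list (\<lambda>ks. \<omega> z (map fib_vec ks @ vs))"
  unfolding antisym_list_def
proof (intro allI)
  fix us a b ks
  show "\<omega> z (map fib_vec (us @ a # b # ks) @ vs) = - \<omega> z (map fib_vec (us @ b # a # ks) @ vs)"
    using alternatingD[OF Fil_alternating[OF assms], of z "map fib_vec us" "fib_vec a" "fib_vec b"
        "map fib_vec ks @ vs"] by simp
qed

text \<open>
  Antisymmetry is inherited from the form, because all vectors but the last are of the same kind.
\<close>

lemma contact_coeff_admissible:
  assumes \<omega>: "\<omega> \<in> Fil W \<rho> s 1"
  shows "admissible W s (contact_coeff \<rho> s \<omega>)"
  unfolding admissible_def
proof (intro conjI allI impI)
  fix i :: 'n and \<alpha>s :: "'m list"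
  let ?vs = "map fib_vec (slots i \<alpha>s) @ base_vecs"
  have "(\<lambda>z. \<omega> z ?vs) \<in> Rinf W"
    using smooth_formD[OF Fil_smooth[OF \<omega>], of ?vs] Fil_outside[OF \<omega>, of _ ?vs]
    unfolding Rinf_def by blast
  moreover have "jsmooth (jets W) (\<lambda>z. inverse (fact (s - 1)) * inverse (\<rho> (base_pt z)))"
    by (intro jsmooth_mult jsmooth_inverse jsmooth_const density_smooth coord_open_jets density_nonzero)
  ultimately have "(\<lambda>z. \<omega> z ?vs * (inverse (fact (s - 1)) * inverse (\<rho> (base_pt z)))) \<in> Rinf W"
    by (rule Rinf_mult[OF open_W])
  then show "contact_coeff \<rho> s \<omega> i \<alpha>s \<in> Rinf W"
    by (simp add: contact_coeff_def[abs_def] divide_inverse)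
next
  fix i :: 'n and \<alpha>s :: "'m list" and p q
  assume *: "length \<alpha>s = s \<and> p < q \<and> q < s - 1"
  then have pq: "p < q" "q < length \<alpha>s" by auto
  obtain us a ms b ws where ws: "\<alpha>s = us @ a # ms @ b # ws" "length us = p"
    "length ms = q - Suc p" "\<alpha>s[p := \<alpha>s ! q, q := \<alpha>s ! p] = us @ b # ms @ a # ws"
    by (rule list_update_swap[OF pq])
  then have "ws \<noteq> []" using * by auto
  then have s: "slots i (us @ x # ms @ y # ws) = map (\<lambda>\<alpha>. (\<alpha>, {#})) us @ (x, {#}) #
      map (\<lambda>\<alpha>. (\<alpha>, {#})) ms @ (y, {#}) # slots i ws" for x y
    by (simp add: slots_def butlast_append)
  have "\<omega> z (map fib_vec (slots i (us @ b # ms @ a # ws)) @ base_vecs) =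
      - \<omega> z (map fib_vec (slots i (us @ a # ms @ b # ws)) @ base_vecs)" for z
    unfolding s by (rule antisym_list_swap[OF Fil_antisym_list[OF \<omega>]])
  then show "contact_coeff \<rho> s \<omega> i (\<alpha>s[p := \<alpha>s ! q, q := \<alpha>s ! p]) = - contact_coeff \<rho> s \<omega> i \<alpha>s"
    unfolding ws(4) unfolding ws(1) by (intro ext) (simp add: contact_coeff_def)
qed

lemma eta_Fil:
  assumes "admissible W s A" "s \<ge> 1"
  shows "eta \<rho> s A \<in> Fil W \<rho> s 1"
  unfolding eta_slots
proof (intro Fil_sum Fil_monomial)
  fix i :: 'n and \<alpha>s :: "'m list" assume \<alpha>s: "\<alpha>s \<in> lists_of s"
  then show "A i \<alpha>s \<in> Rinf W" using assms by (simp add: admissible_def)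
  show "length (slots i \<alpha>s) = s" using \<alpha>s assms(2) by (subst length_slots) auto
  show "weight (slots i \<alpha>s) \<le> 1" using weight_slots[of i \<alpha>s] by simp
qed

text \<open>
  An alternating family of coefficients is recovered from its form: evaluation sums it against a
  determinant, and \<open>sum_kdet_rows\<close> yields the factorial by which \<open>contact_coeff\<close> divides.
\<close>

lemma contact_coeff_eta:
  assumes A: "admissible W s A" and s: "s \<ge> 1" and \<alpha>s: "length \<alpha>s = s" and z: "z \<in> jets W"
  shows "contact_coeff \<rho> s (eta \<rho> s A) i \<alpha>s z = A i \<alpha>s z"
proof -
  obtain k where k: "s = Suc k" using s by (cases s) auto
  obtain \<beta>s \<gamma> where \<beta>s: "\<alpha>s = \<beta>s @ [\<gamma>]" "length \<beta>s = k"
    using \<alpha>s k by (auto simp: length_Suc_conv_rev)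
  let ?M = "\<lambda>js. if Suc (length js) = s then A i (js @ [\<gamma>]) z else 0"
  have "eta \<rho> s A z (map fib_vec (slots i \<alpha>s) @ base_vecs) =
      (\<Sum>j\<in>UNIV. \<Sum>js\<in>lists_of k. \<Sum>\<beta>\<in>UNIV. A j (js @ [\<beta>]) z *
        (kdet js \<beta>s * of_bool (\<beta> = \<gamma> \<and> j = i) * \<rho> (base_pt z)))"
    unfolding eta_apply k sum_lists_snoc
    by (intro sum.cong refl)
      (simp add: \<beta>s monomial_eval length_slots vol_base_vecs kdet_slots)
  also have "\<dots> = (\<Sum>j\<in>UNIV. \<Sum>js\<in>lists_of k. \<Sum>\<beta>\<in>UNIV. if \<beta> = \<gamma> then
      (if j = i then A i (js @ [\<gamma>]) z * kdet js \<beta>s * \<rho> (base_pt z) else 0) else 0)"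
    by (intro sum.cong refl) simp
  also have "\<dots> = (\<Sum>j\<in>UNIV. if j = i then
      (\<Sum>js\<in>lists_of k. A i (js @ [\<gamma>]) z * kdet js \<beta>s * \<rho> (base_pt z)) else 0)"
    by (intro sum.cong refl) simp
  also have "\<dots> = (\<Sum>js\<in>lists_of k. A i (js @ [\<gamma>]) z * kdet js \<beta>s * \<rho> (base_pt z))"
    by simp
  also have "\<dots> = (\<Sum>js\<in>lists_of (length \<beta>s). ?M js * kdet js \<beta>s) * \<rho> (base_pt z)"
    unfolding sum_distrib_right by (intro sum.cong) (simp_all add: \<beta>s k)
  also have "\<dots> = fact (length \<beta>s) * A i \<alpha>s z * \<rho> (base_pt z)"
    unfolding sum_kdet_rows[OF admissible_antisym_list[OF A]] by (simp add: \<beta>s k)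
  finally show ?thesis
    using density_nonzero[OF z] by (simp add: contact_coeff_def \<beta>s k)
qed


lemma eta_zero:
  "(\<And>i \<alpha>s z. length \<alpha>s = s \<Longrightarrow> A i \<alpha>s z = 0) \<Longrightarrow> eta \<rho> s A = 0"
  by (intro ext) (simp add: eta_apply)

text \<open>
  A single term of order one, wherever its differentiated factor stands, is reproduced exactly: its
  contact coefficients are a signed multiple of a determinant, and summing them against the monomials
  undoes the antisymmetrization.
\<close>

lemma eta_contact_coeff_leading:
  fixes \<beta>s \<beta>s' :: "'m list" and \<gamma> :: 'm and i :: 'n
  assumes f: "f \<in> Rinf W"
  defines "\<omega> \<equiv> smul f (monomial \<rho> (map (\<lambda>\<alpha>. (\<alpha>, {#})) \<beta>s @ (\<gamma>, {#i#}) # map (\<lambda>\<alpha>. (\<alpha>, {#})) \<beta>s'))"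
  shows "eta \<rho> (Suc (length \<beta>s + length \<beta>s')) (contact_coeff \<rho> (Suc (length \<beta>s + length \<beta>s')) \<omega>) = \<omega>"
proof (intro ext)
  fix z vs
  define bs where "bs = \<beta>s @ \<beta>s'"
  define k where "k = length bs"
  define c where "c = f z * (-1) ^ length \<beta>s'"
  have k: "length \<beta>s + length \<beta>s' = k" by (simp add: k_def bs_def)
  have \<omega>: "\<omega> z us = c * monomial \<rho> (slots i (bs @ [\<gamma>])) z us" for us
    using antisym_list_move[OF antisym_list_monomial[of \<rho> z us], of "map (\<lambda>\<alpha>. (\<alpha>, {#})) \<beta>s"
        "map (\<lambda>\<alpha>. (\<alpha>, {#})) \<beta>s'" "(\<gamma>, {#i#})" "[]"]
    by (simp add: \<omega>_def c_def smul_apply slots_snoc[of i "\<beta>s @ \<beta>s'" \<gamma>, simplified] bs_def flip: power_add mult_2)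
  show "eta \<rho> (Suc (length \<beta>s + length \<beta>s')) (contact_coeff \<rho> (Suc (length \<beta>s + length \<beta>s')) \<omega>) z vs = \<omega> z vs"
  proof (cases "z \<in> jets W")
    case False
    then have "c = 0" using f by (simp add: c_def Rinf_def)
    then show ?thesis by (simp add: eta_apply contact_coeff_def \<omega>)
  next
    case True
    note \<rho> = density_nonzero[OF True]
    have cc: "contact_coeff \<rho> (Suc k) \<omega> j (\<alpha>s @ [\<alpha>]) z =
        c * kdet bs \<alpha>s * of_bool (\<gamma> = \<alpha> \<and> i = j) / fact k"
      if "length \<alpha>s = k" for j \<alpha>s \<alpha>
      using that \<rho> by (simp add: contact_coeff_def \<omega> monomial_eval length_slots k_def
          vol_base_vecs kdet_slots)
    let ?M = "\<lambda>\<alpha>s. monomial \<rho> (slots i (\<alpha>s @ [\<gamma>])) z vs"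
    have M: "antisym_list ?M"
      unfolding antisym_list_def
    proof (intro allI)
      fix us a b ws
      show "?M (us @ a # b # ws) = - ?M (us @ b # a # ws)"
        using antisym_listD[OF antisym_list_monomial[of \<rho> z vs], of "map (\<lambda>\<alpha>. (\<alpha>, {#})) us" "(a, {#})"
            "(b, {#})" "slots i (ws @ [\<gamma>])"]
        using slots_snoc[of i "us @ a # b # ws" \<gamma>] slots_snoc[of i "us @ b # a # ws" \<gamma>]
        by (simp add: slots_snoc)
    qed
    have "eta \<rho> (Suc k) (contact_coeff \<rho> (Suc k) \<omega>) z vs =
        (\<Sum>j\<in>UNIV. \<Sum>\<alpha>s\<in>lists_of k. \<Sum>\<alpha>\<in>UNIV. if \<gamma> = \<alpha> then
          (if i = j then c / fact k * (kdet bs \<alpha>s * ?M \<alpha>s) else 0) else 0)"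
      unfolding eta_apply sum_lists_snoc by (intro sum.cong refl) (simp add: cc)
    also have "\<dots> = (\<Sum>j\<in>UNIV. if i = j then c / fact k * (\<Sum>\<alpha>s\<in>lists_of k. kdet bs \<alpha>s * ?M \<alpha>s) else 0)"
      unfolding sum_distrib_left by (intro sum.cong refl) simp
    also have "\<dots> = c / fact k * (\<Sum>\<alpha>s\<in>lists_of k. kdet bs \<alpha>s * ?M \<alpha>s)"
      by simp
    also have "\<dots> = \<omega> z vs"
      unfolding k_def sum_kdet_columns[OF M] \<omega> by simp
    finally show ?thesis by (simp add: k)
  qed
qed

text \<open>
  Every class of the graded quotient is thus represented by an alternating family of coefficients.
\<close>

lemma eta_contact_coeff:
  assumes "\<omega> \<in> Fil W \<rho> s 1"
  shows "\<omega> - eta \<rho> s (contact_coeff \<rho> s \<omega>) \<in> Fil W \<rho> s 0"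
  using assms
proof (induction rule: Fil_induct)
  case zero
  have "0 - eta \<rho> s (contact_coeff \<rho> s 0) = (0 :: ('n, 'm) form)"
    by (intro ext) (simp add: eta_apply contact_coeff_def)
  then show ?case using Fil_zero by metis
next
  case (add \<omega> \<phi>)
  have "(\<omega> - eta \<rho> s (contact_coeff \<rho> s \<omega>)) + (\<phi> - eta \<rho> s (contact_coeff \<rho> s \<phi>)) =
      \<omega> + \<phi> - eta \<rho> s (contact_coeff \<rho> s (\<omega> + \<phi>))"
    by (intro ext) (simp add: eta_apply contact_coeff_add algebra_simps sum.distrib)
  then show ?case using Fil_add[OF add(3,4)] by metis
next
  case (monomial f js)
  consider "weight js = 0" | "weight js = 1" using monomial(3) by linarith
  then show ?case
  proof cases
    case 1
    then have f: "smul f (monomial \<rho> js) \<in> Fil W \<rho> s 0"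
      using monomial by (intro Fil_monomial) auto
    have "eta \<rho> s (contact_coeff \<rho> s (smul f (monomial \<rho> js))) = 0"
      by (rule eta_zero) (rule contact_coeff_Fil_0[OF f])
    then show ?thesis using f by (metis diff_zero)
  next
    case 2
    obtain \<beta>s \<gamma> i \<beta>s' where
      js: "js = map (\<lambda>\<alpha>. (\<alpha>, {#})) \<beta>s @ (\<gamma>, {#i#}) # map (\<lambda>\<alpha>. (\<alpha>, {#})) \<beta>s'"
      by (rule weight_one_cases[OF 2])
    then have s: "s = Suc (length \<beta>s + length \<beta>s')" using monomial(2) by simp
    have "eta \<rho> s (contact_coeff \<rho> s (smul f (monomial \<rho> js))) = smul f (monomial \<rho> js)"
      unfolding js s by (rule eta_contact_coeff_leading[OF monomial(1)])
    then show ?thesis using Fil_zero by (metis diff_self)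
  qed
qed

text \<open>
  The contact coefficients are a complete invariant modulo \<open>Fil W \<rho> s 0\<close>.
\<close>

lemma Fil_0_if_contact_coeff_zero:
  assumes \<omega>: "\<omega> \<in> Fil W \<rho> s 1"
    and "\<And>i \<alpha>s z. length \<alpha>s = s \<Longrightarrow> z \<in> jets W \<Longrightarrow> contact_coeff \<rho> s \<omega> i \<alpha>s z = 0"
  shows "\<omega> \<in> Fil W \<rho> s 0"
proof -
  have "contact_coeff \<rho> s \<omega> i \<alpha>s z = 0" if "length \<alpha>s = s" for i \<alpha>s z
    using assms(2)[OF that] Fil_outside[OF \<omega>] by (cases "z \<in> jets W") (simp_all add: contact_coeff_def)
  then have "eta \<rho> s (contact_coeff \<rho> s \<omega>) = 0" by (rule eta_zero)
  then show ?thesis using eta_contact_coeff[OF \<omega>] by (metis diff_zero)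
qed

section \<open>The interior Euler operator on the filtration\<close>

lemma wedge_theta_Fil:
  assumes "\<omega> \<in> Fil W \<rho> s l"
  shows "(theta \<alpha> I \<and>\<^sub>w \<omega>) \<in> Fil W \<rho> (Suc s) (size I + l)"
  using assms
proof (induction rule: Fil_induct)
  case zero
  show ?case unfolding wedge_zero by (rule Fil_zero)
next
  case (add \<omega> \<phi>)
  show ?case unfolding wedge_add by (rule Fil_add[OF add(3,4)])
next
  case (monomial f js)
  show ?case
    unfolding wedge_smul monomial_Cons[symmetric] by (rule Fil_monomial) (use monomial in auto)
qed

text \<open>
  By the Leibniz rule the total derivative prolongs one contact factor at a time and otherwise rescales
  the volume form.  The coefficient \<open>f\<close> vanishes outside of the chart and so makes the formulas, which
  hold on the chart, equalities of forms.
\<close>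

lemma smul_Dtot_monomial_Fil:
  "f \<in> Rinf W \<Longrightarrow> smul f (Dtot W j (monomial \<rho> js)) \<in> Fil W \<rho> (length js) (Suc (weight js))"
proof (induction js)
  case Nil
  then have 0: "f z = 0" if "z \<notin> jets W" for z using that by (simp add: Rinf_def)
  have "smul f (Dtot W j (monomial \<rho> [])) = smul (\<lambda>z. f z * log_derivative j z) (monomial \<rho> [])"
  proof (intro ext)
    fix z vs
    show "smul f (Dtot W j (monomial \<rho> [])) z vs = smul (\<lambda>z. f z * log_derivative j z) (monomial \<rho> []) z vs"
      by (cases "z \<in> jets W") (simp_all add: smul_apply monomial_Nil Dtot_vol 0)
  qed
  then show ?case
    using Fil_monomial[OF Rinf_mult[OF open_W Nil log_derivative_smooth[of j]], of "[]" 0 "Suc 0"]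
    by simp
next
  case (Cons k js)
  obtain \<alpha> I where k: "k = (\<alpha>, I)" by (cases k)
  have 0: "f z = 0" if "z \<notin> jets W" for z using that Cons.prems by (simp add: Rinf_def)
  have "smul f (Dtot W j (monomial \<rho> (k # js))) =
      smul f (monomial \<rho> ((\<alpha>, add_mset j I) # js)) + (theta \<alpha> I \<and>\<^sub>w smul f (Dtot W j (monomial \<rho> js)))"
  proof (intro ext)
    fix z vs
    show "smul f (Dtot W j (monomial \<rho> (k # js))) z vs =
        (smul f (monomial \<rho> ((\<alpha>, add_mset j I) # js)) + (theta \<alpha> I \<and>\<^sub>w smul f (Dtot W j (monomial \<rho> js)))) z vs"
    proof (cases "z \<in> jets W")
      case False
      then show ?thesis unfolding wedge_smul by (simp add: smul_apply 0)
    next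
      case True
      have "(Dtot W j (theta \<alpha> I) \<and>\<^sub>w monomial \<rho> js) z vs = (theta \<alpha> (add_mset j I) \<and>\<^sub>w monomial \<rho> js) z vs"
        by (rule wedge_cong) (simp_all add: Dtot_theta[OF True])
      then show ?thesis
        unfolding wedge_smul k monomial_Cons
          Dtot_wedge[OF open_W one_form_theta smooth_form_theta smooth_form_monomial]
        by (simp add: smul_apply algebra_simps)
    qed
  qed
  moreover have "smul f (monomial \<rho> ((\<alpha>, add_mset j I) # js)) \<in> Fil W \<rho> (length (k # js)) (Suc (weight (k # js)))"
    by (rule Fil_monomial[OF Cons.prems]) (simp_all add: k)
  moreover have "(theta \<alpha> I \<and>\<^sub>w smul f (Dtot W j (monomial \<rho> js))) \<in> Fil W \<rho> (length (k # js)) (Suc (weight (k # js)))"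
    using wedge_theta_Fil[OF Cons.IH[OF Cons.prems], of \<alpha> I] by (simp add: k)
  ultimately show ?case using Fil_add by metis
qed

lemma Dtot_Fil:
  assumes "\<omega> \<in> Fil W \<rho> s l"
  shows "Dtot W j \<omega> \<in> Fil W \<rho> s (Suc l)"
  using assms
proof (induction rule: Fil_induct)
  case zero
  show ?case unfolding Dtot_zero by (rule Fil_zero)
next
  case (add \<omega> \<phi>)
  show ?case
    unfolding Dtot_add[OF Fil_smooth[OF add(1)] Fil_smooth[OF add(2)]] by (rule Fil_add[OF add(3,4)])
next
  case (monomial f js)
  have fs: "jsmooth (jets W) f" using monomial(1) by (simp add: Rinf_def)
  define Df where "Df z = (if z \<in> jets W then dird (total_vf j z) f z else 0)" for z
  have "Df \<in> Rinf W"
    unfolding Df_def by (intro Rinf_restrict open_W jsmooth_dird fs jsmooth_total_vf)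
  then have "smul Df (monomial \<rho> js) \<in> Fil W \<rho> s (Suc l)"
    using monomial by (intro Fil_monomial) auto
  moreover have "smul f (Dtot W j (monomial \<rho> js)) \<in> Fil W \<rho> s (Suc l)"
    using Fil_mono[OF smul_Dtot_monomial_Fil[OF monomial(1), of j js], of "Suc l"] monomial by simp
  moreover have "Dtot W j (smul f (monomial \<rho> js)) =
      smul Df (monomial \<rho> js) + smul f (Dtot W j (monomial \<rho> js))"
  proof (intro ext)
    fix z vs
    show "Dtot W j (smul f (monomial \<rho> js)) z vs =
        (smul Df (monomial \<rho> js) + smul f (Dtot W j (monomial \<rho> js))) z vs"
      using Dtot_smul[OF fs smooth_form_monomial, of z j js vs]
      by (cases "z \<in> jets W") (simp_all add: Dtot_outside smul_apply Df_def)
  qed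
  ultimately show ?case using Fil_add by metis
qed

lemma contract_Fil:
  assumes "\<omega> \<in> Fil W \<rho> (Suc s) l" "size (snd k) \<le> l"
  shows "contract (fib_vec k) \<omega> \<in> Fil W \<rho> s (l - size (snd k))"
  using assms(1)
proof (induction rule: Fil_induct)
  case zero
  have "contract (fib_vec k) 0 = (0 :: ('n, 'm) form)" by (intro ext) (simp add: contract_apply)
  then show ?case using Fil_zero by metis
next
  case (add \<omega> \<phi>)
  have "contract (fib_vec k) (\<omega> + \<phi>) = contract (fib_vec k) \<omega> + contract (fib_vec k) \<phi>"
    by (intro ext) (simp add: contract_apply)
  then show ?case using Fil_add[OF add(3,4)] by metis
next
  case (monomial f js)
  let ?c = "\<lambda>r. (-1) ^ r * of_bool (js ! r = k) :: real"
  have "contract (fib_vec k) (smul f (monomial \<rho> js)) =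
      (\<Sum>r<length js. smul (\<lambda>z. ?c r * f z) (monomial \<rho> (del r js)))"
    by (intro ext) (simp add: contract_apply smul_apply sum_form_apply contract_monomial_apply
        sum_distrib_left mult_ac)
  moreover have "smul (\<lambda>z. ?c r * f z) (monomial \<rho> (del r js)) \<in> Fil W \<rho> s (l - size (snd k))"
    if "r < length js" for r
  proof (cases "js ! r = k")
    case True
    then have "weight (del r js) \<le> l - size (snd k)"
      using weight_del[OF that] monomial(3) by simp
    then show ?thesis
      using that monomial(2)
      by (intro Fil_monomial Rinf_scale open_W monomial(1)) (simp_all add: length_del)
  next
    case False
    then have "smul (\<lambda>z. ?c r * f z) (monomial \<rho> (del r js)) = 0"
      by (intro ext) (simp add: smul_apply)
    then show ?thesis using Fil_zero by metis
  qed
  ultimately show ?case using Fil_sum[of "{..<length js}"] by (metis (no_types, lifting) lessThan_iff)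
qed

lemma contract_excess:
  assumes "\<omega> \<in> Fil W \<rho> s l" "l < size (snd k)"
  shows "contract (fib_vec k) \<omega> = 0"
proof (intro ext)
  fix z vs
  show "contract (fib_vec k) \<omega> z vs = 0 z vs"
    using Fil_excess[OF assms(1), of "[k]" z vs] assms(2) by (cases k) (simp add: contract_apply)
qed

lemma neg_D_zero: "neg_D W I 0 = 0"
proof -
  have "foldr (\<lambda>j \<phi>. - Dtot W j \<phi>) xs 0 = 0" for xs
  proof (induction xs)
    case (Cons j xs)
    show ?case
      unfolding foldr.simps o_apply Cons Dtot_zero by (rule minus_zero)
  qed simp
  then show ?thesis unfolding neg_D_def .
qed

text \<open>
  The form that the interior Euler operator multiplies by \<open>theta \<alpha> {#}\<close>, written out for elements of
  \<open>Fil W \<rho> s 1\<close>, where contractions of order two and higher vanish.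
\<close>

definition euler_factor :: "('n, 'm) form \<Rightarrow> 'm \<Rightarrow> ('n, 'm) form" where
  "euler_factor \<omega> \<alpha> = contract (fib_vec (\<alpha>, {#})) \<omega>
     + (\<Sum>j\<in>UNIV. - Dtot W j (contract (fib_vec (\<alpha>, {#j#})) \<omega>))"

lemma euler_factor:
  assumes "\<omega> \<in> Fil W \<rho> s 1"
  shows "Sum_any (\<lambda>I. neg_D W I (contract (coord_vec (Fib \<alpha> I)) \<omega>)) = euler_factor \<omega> \<alpha>"
proof -
  let ?F = "\<lambda>I. neg_D W I (contract (coord_vec (Fib \<alpha> I)) \<omega>)"
  let ?S = "insert {#} (range (\<lambda>j. {#j#})) :: 'n multiset set"
  have 0: "?F I = 0" if "I \<notin> ?S" for I
  proof -
    have "size I \<noteq> 0" "size I \<noteq> 1"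
      using that size_1_singleton_mset[of I] by auto
    then have "1 < size I" by linarith
    then have "contract (coord_vec (Fib \<alpha> I)) \<omega> = 0"
      using contract_excess[OF assms, of "(\<alpha>, I)"] by simp
    then show ?thesis using neg_D_zero by metis
  qed
  have "Sum_any ?F = sum ?F ?S"
    by (rule Sum_any.expand_superset) (use 0 in auto)
  also have "\<dots> = ?F {#} + (\<Sum>j\<in>UNIV. ?F {#j#})"
    by (subst sum.insert) (auto simp: sum.reindex inj_on_def)
  also have "\<dots> = euler_factor \<omega> \<alpha>"
    by (simp add: euler_factor_def neg_D_def)
  finally show ?thesis .
qed

lemma euler_factor_Fil:
  assumes "\<omega> \<in> Fil W \<rho> (Suc s) 1"
  shows "euler_factor \<omega> \<alpha> \<in> Fil W \<rho> s 1"
proof -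
  have "contract (fib_vec (\<alpha>, {#})) \<omega> \<in> Fil W \<rho> s 1"
    using contract_Fil[OF assms, of "(\<alpha>, {#})"] by simp
  moreover have "Dtot W j (contract (fib_vec (\<alpha>, {#j#})) \<omega>) \<in> Fil W \<rho> s 1" for j
    using Dtot_Fil[OF contract_Fil[OF assms, of "(\<alpha>, {#j#})"], of j] by simp
  ultimately show ?thesis
    unfolding euler_factor_def by (intro Fil_add Fil_sum Fil_minus)
qed

lemma interior_euler_eq:
  assumes "\<omega> \<in> Fil W \<rho> s 1"
  shows "interior_euler W s \<omega> = smul (\<lambda>_. 1 / real s) (\<Sum>\<alpha>\<in>UNIV. theta \<alpha> {#} \<and>\<^sub>w euler_factor \<omega> \<alpha>)"
  unfolding interior_euler_def euler_factor[OF assms] ..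

lemma interior_euler_Fil:
  assumes "\<omega> \<in> Fil W \<rho> s 1" "s \<ge> 1"
  shows "interior_euler W s \<omega> \<in> Fil W \<rho> s 1"
proof -
  obtain k where k: "s = Suc k" using assms(2) by (cases s) auto
  have "(theta \<alpha> {#} \<and>\<^sub>w euler_factor \<omega> \<alpha>) \<in> Fil W \<rho> s 1" for \<alpha>
    using wedge_theta_Fil[OF euler_factor_Fil[OF assms(1)[unfolded k]], of \<alpha> "{#}"] by (simp add: k)
  then show ?thesis
    unfolding interior_euler_eq[OF assms(1)] by (intro Fil_scale Fil_sum)
qed

end

section \<open>Cyclic sums\<close>

lemma antisym_list_block:
  "antisym_list M \<Longrightarrow> M (us @ ws) = (-1) ^ (length us * length ws) * M (ws @ us)"
proof (induction ws arbitrary: M)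
  case (Cons w ws)
  have "M (us @ w # ws) = (-1) ^ length us * M (w # us @ ws)"
    using antisym_list_move[OF Cons.prems, of "[]" us w ws] by simp
  also have "M (w # us @ ws) = (-1) ^ (length us * length ws) * M (w # ws @ us)"
    by (rule Cons.IH[OF antisym_list_Cons[OF Cons.prems]])
  finally show ?case by (simp add: power_add)
qed simp

text \<open>
  Rotating by \<open>r + 1\<close> puts the entry \<open>r\<close> last and exchanges the blocks before and after it.  Undoing the
  exchange costs a sign, so for functions alternating in all but the last index the cyclic sum runs over
  the choice of the last index.
\<close>

lemma sum_rotations:
  fixes N :: "'a list \<Rightarrow> real"
  assumes N: "\<And>\<gamma>. antisym_list (\<lambda>\<beta>s. N (\<beta>s @ [\<gamma>]))" and \<alpha>s: "length \<alpha>s = Suc k"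
  shows "(\<Sum>l<Suc k. (-1) ^ (k * l) * N (rotate l \<alpha>s)) =
    N \<alpha>s + (\<Sum>r<k. (-1) ^ (r + k) * N (del r \<alpha>s @ [\<alpha>s ! r]))"
proof -
  have "(-1) ^ (k * Suc r) * N (rotate (Suc r) \<alpha>s) = (-1) ^ (r + k) * N (del r \<alpha>s @ [\<alpha>s ! r])"
    if r: "r < k" for r
  proof -
    obtain d where d: "k = r + d" using r by (metis less_imp_add_positive)
    let ?D = "drop (Suc r) \<alpha>s" and ?T = "take r \<alpha>s"
    have "rotate (Suc r) \<alpha>s = (?D @ ?T) @ [\<alpha>s ! r]"
      using r \<alpha>s by (simp add: rotate_drop_take take_Suc_conv_app_nth)
    also have "N \<dots> = (-1) ^ (length ?D * length ?T) * N ((?T @ ?D) @ [\<alpha>s ! r])"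
      by (rule antisym_list_block[OF N])
    also have "length ?D * length ?T = d * r" using d \<alpha>s by simp
    finally have "N (rotate (Suc r) \<alpha>s) = (-1) ^ (d * r) * N (del r \<alpha>s @ [\<alpha>s ! r])"
      by (simp add: del_def)
    \<comment> \<open>Both exponents have the parity of \<open>d\<close>.\<close>
    moreover have "(-1 :: real) ^ (k * Suc r) * (-1) ^ (d * r) = (-1) ^ (r + k)"
      unfolding d power_add[symmetric] minus_one_power_iff by auto
    ultimately show ?thesis by (metis mult.assoc)
  qed
  then show ?thesis
    by (simp add: sum.lessThan_Suc_shift del: sum.lessThan_Suc)
qed

text \<open>
  The sign \<open>(-1) ^ (k * (k + 1))\<close> of a full rotation is trivial, which closes the cycle.
\<close>

lemma cyclic_sum_rotate1:
  assumes \<alpha>s: "length \<alpha>s = Suc k"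
  shows "(-1) ^ k * cyclic_sum (Suc k) A i (rotate1 \<alpha>s) z = cyclic_sum (Suc k) A i \<alpha>s z"
proof -
  define F where "F l = (-1) ^ (k * l) * A i (rotate l \<alpha>s) z" for l
  have "F (Suc k) = F 0"
    using \<alpha>s rotate_id[of "Suc k" \<alpha>s] by (simp add: F_def minus_one_power_iff)
  have "(-1) ^ k * cyclic_sum (Suc k) A i (rotate1 \<alpha>s) z = (\<Sum>l<Suc k. F (Suc l))"
    unfolding cyclic_sum_def F_def sum_distrib_left
    by (intro sum.cong refl) (simp add: rotate1_rotate_swap power_add)
  also have "\<dots> = (\<Sum>l<Suc k. F l)"
    using \<open>F (Suc k) = F 0\<close> sum.lessThan_Suc_shift[of F "Suc k"] sum.lessThan_Suc[of F "Suc k"] by linarith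
  finally show ?thesis by (simp add: cyclic_sum_def F_def)
qed

text \<open>Up to the factor \<open>s\<close> the cyclic sum is the projection to the coefficients with cyclic symmetry.\<close>

lemma cyclic_sum_idempotent:
  assumes \<alpha>s: "length \<alpha>s = s" and s: "s \<ge> 1"
  shows "cyclic_sum s (cyclic_sum s A) i \<alpha>s z = real s * cyclic_sum s A i \<alpha>s z"
proof -
  obtain k where k: "s = Suc k" using s by (cases s) auto
  have rot: "(-1) ^ (k * l) * cyclic_sum s A i (rotate l \<alpha>s) z = cyclic_sum s A i \<alpha>s z" for l
  proof (induction l)
    case (Suc l)
    have "length (rotate l \<alpha>s) = Suc k" using \<alpha>s k by simp
    from cyclic_sum_rotate1[OF this, of A i z] Suc show ?case
      by (simp add: k power_add) (metis mult.assoc mult.commute)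
  qed simp
  have "cyclic_sum s (cyclic_sum s A) i \<alpha>s z = (\<Sum>l<s. cyclic_sum s A i \<alpha>s z)"
    unfolding cyclic_sum_def[of s "cyclic_sum s A"] by (intro sum.cong refl) (use rot k in simp)
  then show ?thesis by simp
qed

lemma cyclic_sum_cong:
  assumes "\<And>\<alpha>s. length \<alpha>s = s \<Longrightarrow> A i \<alpha>s z = B i \<alpha>s z" "length \<alpha>s = s"
  shows "cyclic_sum s A i \<alpha>s z = cyclic_sum s B i \<alpha>s z"
  unfolding cyclic_sum_def by (intro sum.cong refl) (simp add: assms)

section \<open>Leading coefficients of the interior Euler operator\<close>

context adapted_chart
begin

text \<open>
  The one-form cannot take one of the further vectors, since too many fibre coordinate vectors would be
  left for the other factor.
\<close>

lemma wedge_theta_eval: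
  assumes \<phi>: "\<phi> \<in> Fil W \<rho> k l" and K: "length K = Suc k"
  shows "(theta \<alpha> I \<and>\<^sub>w \<phi>) z (map fib_vec K @ vs) =
    (\<Sum>r<Suc k. (-1) ^ r * of_bool ((\<alpha>, I) = K ! r) * \<phi> z (map fib_vec (del r K) @ vs))"
proof -
  let ?V = "map fib_vec K @ vs"
  let ?t = "\<lambda>r. (-1) ^ r * theta \<alpha> I z [?V ! r] * \<phi> z (del r ?V)"
  have "?t r = 0" if "\<not> r < Suc k" for r
  proof -
    have "Suc k \<le> r" using that by simp
    then obtain q where "r = Suc k + q" using le_Suc_ex by blast
    then have "del r ?V = map fib_vec K @ del q vs"
      using K by (simp add: del_def)
    then show ?thesis using Fil_excess[OF \<phi>, of K] K by simp
  qed
  then have "(theta \<alpha> I \<and>\<^sub>w \<phi>) z ?V = (\<Sum>r<Suc k. ?t r)"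
    unfolding wedge_one_form[OF one_form_theta] using K
    by (intro sum.mono_neutral_right) auto
  also have "\<dots> = (\<Sum>r<Suc k. (-1) ^ r * of_bool ((\<alpha>, I) = K ! r) * \<phi> z (map fib_vec (del r K) @ vs))"
  proof (intro sum.cong refl)
    fix r assume "r \<in> {..<Suc k}"
    then have r: "r < length K" using K by simp
    have "?V ! r = fib_vec (K ! r)" using r by (simp add: nth_append)
    moreover have "del r ?V = map fib_vec (del r K) @ vs"
      using r by (simp add: del_def take_map drop_map)
    ultimately show "?t r = (-1) ^ r * of_bool ((\<alpha>, I) = K ! r) * \<phi> z (map fib_vec (del r K) @ vs)"
      by (simp only: theta_fib_vec)
  qed
  finally show ?thesis .
qed

text \<open>
  This is where the calculation becomes short.  The contracted form, evaluated on constant coordinate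
  vectors, involves two vectors of order one and therefore vanishes identically, so no derivative of a
  coefficient survives.  Among the bracket terms only the one that lowers the vector of order one is left,
  and moving the contracting vector into the vacated last place gives a permuted coefficient.
\<close>

lemma Dtot_contract_eval:
  fixes \<beta>s :: "'m list"
  assumes \<omega>: "\<omega> \<in> Fil W \<rho> s 1" and z: "z \<in> jets W"
  shows "Dtot W j (contract (fib_vec (\<beta>, {#j#})) \<omega>) z (map fib_vec (slots i (\<beta>s @ [\<gamma>])) @ base_vecs) =
    of_bool (j = i) * ((-1) ^ Suc (length \<beta>s) *
      \<omega> z (map fib_vec (slots i (\<beta>s @ [\<gamma>, \<beta>])) @ base_vecs))"
proof -
  let ?E = "map (\<lambda>\<alpha>. (\<alpha>, {#})) \<beta>s"
  let ?V = "map fib_vec (slots i (\<beta>s @ [\<gamma>])) @ base_vecs"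
  let ?n = "length \<beta>s"
  let ?t = "\<lambda>p. contract (fib_vec (\<beta>, {#j#})) \<omega> z (?V[p := shift j (?V ! p)])"
  have "contract (fib_vec (\<beta>, {#j#})) \<omega> y ?V = 0" for y
    using Fil_excess[OF \<omega>, of "(\<beta>, {#j#}) # slots i (\<beta>s @ [\<gamma>])" y base_vecs]
      weight_slots[of i "\<beta>s @ [\<gamma>]"]
    by (simp add: contract_apply)
  then have "Dtot W j (contract (fib_vec (\<beta>, {#j#})) \<omega>) z ?V = (\<Sum>p<length ?V. ?t p)"
    by (simp add: Dtot_apply[OF z])
  also have "\<dots> = (\<Sum>p\<in>{?n}. ?t p)"
  proof (rule sum.mono_neutral_right)
    show "\<forall>p\<in>{..<length ?V} - {?n}. ?t p = 0"
    proof
      fix p assume p: "p \<in> {..<length ?V} - {?n}"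
      have "shift j (?V ! p) = (\<lambda>_. 0)"
      proof (cases "p < ?n")
        case True
        then have "?V ! p = fib_vec (\<beta>s ! p, {#})" by (simp add: slots_snoc nth_append)
        then show ?thesis by (simp only: shift_fib_vec) simp
      next
        case False
        then have "Suc ?n \<le> p" using p by simp
        then obtain q where q: "p = Suc ?n + q" using le_Suc_ex by blast
        have "?V ! p = base_vecs ! q"
          by (simp add: q slots_snoc nth_append)
        also have "\<dots> = coord_vec (Base (sorted_list_of_set UNIV ! q))"
          using p by (simp add: q slots_snoc base_vecs_def)
        finally show ?thesis by (simp only: shift_coord_vec_Base)
      qed
      then have "?V[p := shift j (?V ! p)] = take p ?V @ (\<lambda>_. 0) # drop (Suc p) ?V"
        using p by (simp only: upd_conv_take_nth_drop lessThan_iff Diff_iff)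
      then show "?t p = 0"
        unfolding contract_apply
        using null_vecD[OF Fil_null_vec[OF \<omega>], of z "fib_vec (\<beta>, {#j#}) # take p ?V"] by simp
    qed
  qed (simp_all add: slots_snoc)
  also have "\<dots> = of_bool (j = i) * ((-1) ^ Suc ?n * \<omega> z (map fib_vec (slots i (\<beta>s @ [\<gamma>, \<beta>])) @ base_vecs))"
  proof -
    have V: "?V ! ?n = fib_vec (\<gamma>, {#i#})"
      "?V[?n := v] = map fib_vec ?E @ v # base_vecs" for v
      by (simp_all add: slots_snoc nth_append list_update_append)
    show ?thesis
    proof (cases "j = i")
      case False
      then show ?thesis
        using null_vecD[OF Fil_null_vec[OF \<omega>], of z "fib_vec (\<beta>, {#j#}) # map fib_vec ?E" base_vecs]
        by (simp add: V shift_fib_vec contract_apply del: fib_vec.simps)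
    next
      case True
      have s: "slots i (\<beta>s @ [\<gamma>, \<beta>]) = (?E @ [(\<gamma>, {#})]) @ [(\<beta>, {#i#})]"
        using slots_snoc[of i "\<beta>s @ [\<gamma>]" \<beta>] by simp
      have "\<omega> z (map fib_vec ([] @ (?E @ [(\<gamma>, {#})]) @ (\<beta>, {#i#}) # []) @ base_vecs) =
          (-1) ^ length (?E @ [(\<gamma>, {#} :: 'n multiset)]) *
          \<omega> z (map fib_vec ([] @ (\<beta>, {#i#}) # (?E @ [(\<gamma>, {#})]) @ []) @ base_vecs)"
        by (rule antisym_list_move[OF Fil_antisym_list[OF \<omega>]])
      then show ?thesis
        using True
        by (simp add: V shift_fib_vec contract_apply s del: fib_vec.simps flip: power_add mult_2)
    qed
  qed
  finally show ?thesis .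
qed

text \<open>
  The contraction of order zero contributes the coefficient itself, up to the sign for restoring the
  order of the indices; the contractions of order one contribute the coefficient whose last index is
  \<open>\<beta>s ! r\<close>.
\<close>

lemma euler_factor_eval:
  fixes \<beta>s :: "'m list" and i :: 'n
  assumes \<omega>: "\<omega> \<in> Fil W \<rho> s 1" and z: "z \<in> jets W" and r: "r < length \<beta>s"
  defines "\<Omega> \<equiv> \<lambda>\<alpha>s. \<omega> z (map fib_vec (slots i \<alpha>s) @ base_vecs)"
  shows "euler_factor \<omega> (\<beta>s ! r) z (map fib_vec (slots i (del r \<beta>s @ [\<gamma>])) @ base_vecs) =
    (-1) ^ r * \<Omega> (\<beta>s @ [\<gamma>]) - (-1) ^ length \<beta>s * \<Omega> (del r \<beta>s @ [\<gamma>, \<beta>s ! r])"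
proof -
  let ?E = "\<lambda>xs. map (\<lambda>\<alpha>. (\<alpha>, {#})) xs :: ('m \<times> 'n multiset) list"
  have b: "?E \<beta>s = ?E (take r \<beta>s) @ (\<beta>s ! r, {#}) # ?E (drop (Suc r) \<beta>s)"
    by (subst id_take_nth_drop[OF r]) (simp only: map_append list.map)
  have "\<omega> z (map fib_vec ([] @ ?E (take r \<beta>s) @ (\<beta>s ! r, {#}) # (?E (drop (Suc r) \<beta>s) @ [(\<gamma>, {#i#})])) @ base_vecs)
      = (-1) ^ length (?E (take r \<beta>s)) * \<omega> z (map fib_vec ([] @ (\<beta>s ! r, {#}) # ?E (take r \<beta>s) @
          (?E (drop (Suc r) \<beta>s) @ [(\<gamma>, {#i#})])) @ base_vecs)"
    by (rule antisym_list_move[OF Fil_antisym_list[OF \<omega>]])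
  moreover have "slots i (\<beta>s @ [\<gamma>]) =
      [] @ ?E (take r \<beta>s) @ (\<beta>s ! r, {#}) # (?E (drop (Suc r) \<beta>s) @ [(\<gamma>, {#i#})])"
    by (simp only: slots_snoc b append_Nil append_assoc append_Cons)
  moreover have "(\<beta>s ! r, {#}) # slots i (del r \<beta>s @ [\<gamma>]) = [] @ (\<beta>s ! r, {#}) # ?E (take r \<beta>s) @
          (?E (drop (Suc r) \<beta>s) @ [(\<gamma>, {#i#})])"
    unfolding slots_snoc by (simp add: del_def)
  ultimately have "\<Omega> (\<beta>s @ [\<gamma>]) = (-1) ^ length (?E (take r \<beta>s)) *
      \<omega> z (map fib_vec ((\<beta>s ! r, {#}) # slots i (del r \<beta>s @ [\<gamma>])) @ base_vecs)"
    unfolding \<Omega>_def by metis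
  then have "\<omega> z (fib_vec (\<beta>s ! r, {#}) # map fib_vec (slots i (del r \<beta>s @ [\<gamma>])) @ base_vecs)
      = (-1) ^ r * \<Omega> (\<beta>s @ [\<gamma>])"
    using r by (simp add: min_absorb2 flip: power_add mult_2)
  moreover have "(\<Sum>j\<in>UNIV. Dtot W j (contract (fib_vec (\<beta>s ! r, {#j#})) \<omega>) z
      (map fib_vec (slots i (del r \<beta>s @ [\<gamma>])) @ base_vecs)) =
      (-1) ^ length \<beta>s * \<Omega> (del r \<beta>s @ [\<gamma>, \<beta>s ! r])"
  proof -
    have l: "Suc (length (del r \<beta>s)) = length \<beta>s" using r by (simp add: length_del)
    have "of_bool (j = i) * x = (if j = i then x else 0)" for j and x :: real by simp
    then show ?thesis
      unfolding Dtot_contract_eval[OF \<omega> z] l \<Omega>_def by simp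
  qed
  ultimately show ?thesis
    unfolding euler_factor_def plus_fun_apply sum_form_apply by (simp add: contract_apply sum_negf)
qed

text \<open>
  On leading coefficients \<open>s\<close> times the interior Euler operator is \<open>s\<close> minus the cyclic sum.  Each of the
  first \<open>s - 1\<close> positions contributes the coefficient itself and one signed permutation of it, and
  \<open>sum_rotations\<close> identifies these permutations with the non-trivial rotations.
\<close>

lemma contact_coeff_interior_euler:
  assumes \<omega>: "\<omega> \<in> Fil W \<rho> s 1" and s: "s \<ge> 1" and z: "z \<in> jets W" and \<alpha>s: "length \<alpha>s = s"
  shows "real s * contact_coeff \<rho> s (interior_euler W s \<omega>) i \<alpha>s z =
    real s * contact_coeff \<rho> s \<omega> i \<alpha>s z - cyclic_sum s (contact_coeff \<rho> s \<omega>) i \<alpha>s z"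
proof -
  obtain k where k: "s = Suc k" using s by (cases s) auto
  obtain \<beta>s \<gamma> where \<beta>s: "\<alpha>s = \<beta>s @ [\<gamma>]" "length \<beta>s = k"
    using \<alpha>s k by (auto simp: length_Suc_conv_rev)
  define \<Omega> where "\<Omega> \<alpha>s = \<omega> z (map fib_vec (slots i \<alpha>s) @ base_vecs)" for \<alpha>s
  define d where "d = fact k * \<rho> (base_pt z)"
  let ?V = "map fib_vec (slots i \<alpha>s) @ base_vecs"
  let ?S = "slots i \<alpha>s"
  have S: "length ?S = Suc k" using \<beta>s by (simp add: length_slots)
  have cc: "contact_coeff \<rho> s \<omega> i \<delta>s z = \<Omega> \<delta>s / d" for \<delta>s
    by (simp add: contact_coeff_def \<Omega>_def d_def k)
  have N: "antisym_list (\<lambda>\<beta>s. \<Omega> (\<beta>s @ [\<delta>]))" for \<delta>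
    unfolding antisym_list_def
  proof (intro allI)
    fix us a b vs
    show "\<Omega> ((us @ a # b # vs) @ [\<delta>]) = - \<Omega> ((us @ b # a # vs) @ [\<delta>])"
      using antisym_listD[OF Fil_antisym_list[OF \<omega>], of z "map (\<lambda>\<alpha>. (\<alpha>, {#})) us" "(a, {#})"
          "(b, {#})" "map (\<lambda>\<alpha>. (\<alpha>, {#})) vs @ [(\<delta>, {#i#})]" base_vecs]
      unfolding \<Omega>_def slots_snoc by simp
  qed
  \<comment> \<open>The vector of order one does not pair with the undifferentiated contact form.\<close>
  have last: "((\<alpha>, {#}) = ?S ! k) = False" for \<alpha>
    using \<beta>s by (simp add: slots_snoc nth_append)
  have ef: "euler_factor \<omega> \<alpha> \<in> Fil W \<rho> k 1" for \<alpha>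
    by (rule euler_factor_Fil[OF \<omega>[unfolded k]])
  have "real s * interior_euler W s \<omega> z ?V = (\<Sum>\<alpha>\<in>UNIV. (theta \<alpha> {#} \<and>\<^sub>w euler_factor \<omega> \<alpha>) z ?V)"
    using s by (simp add: interior_euler_eq[OF \<omega>] smul_apply sum_form_apply)
  also have "\<dots> = (\<Sum>\<alpha>\<in>UNIV. \<Sum>r<Suc k. (-1) ^ r * of_bool ((\<alpha>, {#}) = ?S ! r) *
      euler_factor \<omega> \<alpha> z (map fib_vec (del r ?S) @ base_vecs))"
    unfolding wedge_theta_eval[OF ef S] ..
  also have "\<dots> = (\<Sum>\<alpha>\<in>UNIV. \<Sum>r<k. (-1) ^ r * of_bool ((\<alpha>, {#}) = ?S ! r) *
      euler_factor \<omega> \<alpha> z (map fib_vec (del r ?S) @ base_vecs))"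
    by (simp add: last)
  also have "\<dots> = (\<Sum>r<k. \<Sum>\<alpha>\<in>UNIV. (-1) ^ r * of_bool ((\<alpha>, {#}) = ?S ! r) *
      euler_factor \<omega> \<alpha> z (map fib_vec (del r ?S) @ base_vecs))"
    by (rule sum.swap)
  also have "\<dots> = (\<Sum>r<k. \<Omega> \<alpha>s - (-1) ^ (r + k) * \<Omega> (del r \<alpha>s @ [\<alpha>s ! r]))"
  proof (intro sum.cong refl)
    fix r assume "r \<in> {..<k}"
    then have r: "r < length \<beta>s" using \<beta>s by simp
    have "?S ! r = (\<beta>s ! r, {#})" using r by (simp add: \<beta>s slots_snoc nth_append)
    moreover have "del r ?S = slots i (del r \<beta>s @ [\<gamma>])"
      unfolding \<beta>s slots_snoc using r by (simp add: del_def take_map drop_map)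
    moreover have D: "del r \<alpha>s @ [\<alpha>s ! r] = del r \<beta>s @ [\<gamma>, \<beta>s ! r]"
      using r by (simp add: \<beta>s del_def nth_append)
    ultimately have "(\<Sum>\<alpha>\<in>UNIV. (-1) ^ r * of_bool ((\<alpha>, {#}) = ?S ! r) *
        euler_factor \<omega> \<alpha> z (map fib_vec (del r ?S) @ base_vecs)) =
        (\<Sum>\<alpha>\<in>UNIV. if \<alpha> = \<beta>s ! r then (-1) ^ r *
          euler_factor \<omega> \<alpha> z (map fib_vec (slots i (del r \<beta>s @ [\<gamma>])) @ base_vecs) else 0)"
      by (intro sum.cong refl) simp
    also have "\<dots> = (-1) ^ r * euler_factor \<omega> (\<beta>s ! r) z (map fib_vec (slots i (del r \<beta>s @ [\<gamma>])) @ base_vecs)"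
      by simp
    also have "\<dots> = (-1) ^ r * ((-1) ^ r * \<Omega> \<alpha>s - (-1) ^ k * \<Omega> (del r \<alpha>s @ [\<alpha>s ! r]))"
      unfolding euler_factor_eval[OF \<omega> z r] D \<beta>s(2) by (simp only: \<beta>s(1) \<Omega>_def)
    also have "\<dots> = \<Omega> \<alpha>s - (-1) ^ (r + k) * \<Omega> (del r \<alpha>s @ [\<alpha>s ! r])"
      by (simp add: right_diff_distrib power_add flip: mult.assoc power_mult_distrib)
    finally show "(\<Sum>\<alpha>\<in>UNIV. (-1) ^ r * of_bool ((\<alpha>, {#}) = ?S ! r) *
        euler_factor \<omega> \<alpha> z (map fib_vec (del r ?S) @ base_vecs)) =
        \<Omega> \<alpha>s - (-1) ^ (r + k) * \<Omega> (del r \<alpha>s @ [\<alpha>s ! r])" .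
  qed
  also have "\<dots> = real s * \<Omega> \<alpha>s - (\<Sum>l<Suc k. (-1) ^ (k * l) * \<Omega> (rotate l \<alpha>s))"
    unfolding sum_rotations[OF N \<alpha>s[unfolded k]] by (simp add: sum_subtractf k algebra_simps)
  finally have "real s * interior_euler W s \<omega> z ?V / d =
      (real s * \<Omega> \<alpha>s - (\<Sum>l<Suc k. (-1) ^ (k * l) * \<Omega> (rotate l \<alpha>s))) / d"
    by simp
  moreover have "cyclic_sum s (contact_coeff \<rho> s \<omega>) i \<alpha>s z =
      (\<Sum>l<Suc k. (-1) ^ (k * l) * \<Omega> (rotate l \<alpha>s)) / d"
    unfolding cyclic_sum_def cc by (simp add: k sum_divide_distrib del: sum.lessThan_Suc)
  moreover have "real s * contact_coeff \<rho> s (interior_euler W s \<omega>) i \<alpha>s z =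
      real s * interior_euler W s \<omega> z ?V / d"
    by (simp add: contact_coeff_def d_def k)
  ultimately show ?thesis
    by (simp add: cc diff_divide_distrib)
qed

section \<open>Action on the graded quotient\<close>

lemma gr1_class_eq: "gr1_class W \<rho> s \<omega> = (\<lambda>h. h + \<omega>) ` Fil W \<rho> s 0"
  by (auto simp: gr1_class_def r_coset_def Fil_group_def)

lemma gr1_class_eqI:
  assumes "\<omega> - \<phi> \<in> Fil W \<rho> s 0"
  shows "gr1_class W \<rho> s \<omega> = gr1_class W \<rho> s \<phi>"
proof -
  have *: "gr1_class W \<rho> s \<omega> \<subseteq> gr1_class W \<rho> s \<phi>" if "\<omega> - \<phi> \<in> Fil W \<rho> s 0" for \<omega> \<phi>
  proof
    fix \<psi> assume "\<psi> \<in> gr1_class W \<rho> s \<omega>"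
    then obtain h where h: "h \<in> Fil W \<rho> s 0" "\<psi> = h + \<omega>"
      unfolding gr1_class_eq by blast
    have "\<psi> = (h + (\<omega> - \<phi>)) + \<phi>" unfolding h(2) by (intro ext) simp
    then show "\<psi> \<in> gr1_class W \<rho> s \<phi>"
      unfolding gr1_class_eq using Fil_add[OF h(1) that] by blast
  qed
  have "\<phi> - \<omega> = - (\<omega> - \<phi>)" by (intro ext) simp
  then have "\<phi> - \<omega> \<in> Fil W \<rho> s 0" using Fil_minus[OF assms] by metis
  then show ?thesis using *[OF assms] * by blast
qed

lemma gr1_class_eq_Fil_0_iff: "gr1_class W \<rho> s \<omega> = Fil W \<rho> s 0 \<longleftrightarrow> \<omega> \<in> Fil W \<rho> s 0"
proof
  assume "gr1_class W \<rho> s \<omega> = Fil W \<rho> s 0"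
  moreover have "0 + \<omega> \<in> gr1_class W \<rho> s \<omega>"
    unfolding gr1_class_eq by (rule imageI) (rule Fil_zero)
  ultimately show "\<omega> \<in> Fil W \<rho> s 0" by (metis add_0)
next
  assume "\<omega> \<in> Fil W \<rho> s 0"
  then have "\<omega> - 0 \<in> Fil W \<rho> s 0" by (metis diff_zero)
  then have "gr1_class W \<rho> s \<omega> = gr1_class W \<rho> s 0" by (rule gr1_class_eqI)
  also have "\<dots> = Fil W \<rho> s 0"
    unfolding gr1_class_eq by (metis (no_types, lifting) add.right_neutral image_ident image_cong)
  finally show "gr1_class W \<rho> s \<omega> = Fil W \<rho> s 0" .
qed

lemma carrier_Gr1: "carrier (Gr1 W \<rho> s) = gr1_class W \<rho> s ` Fil W \<rho> s 1"
  by (auto simp: Gr1_def FactGroup_def RCOSETS_def gr1_class_def Fil_group_def)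

lemma one_Gr1: "\<one>\<^bsub>Gr1 W \<rho> s\<^esub> = Fil W \<rho> s 0"
  by (simp add: Gr1_def FactGroup_def)

lemma Fil_0_diffI:
  assumes "\<omega> \<in> Fil W \<rho> s 1" "\<phi> \<in> Fil W \<rho> s 1"
    and "\<And>i \<alpha>s z. length \<alpha>s = s \<Longrightarrow> z \<in> jets W \<Longrightarrow>
      contact_coeff \<rho> s \<omega> i \<alpha>s z = contact_coeff \<rho> s \<phi> i \<alpha>s z"
  shows "\<omega> - \<phi> \<in> Fil W \<rho> s 0"
  by (rule Fil_0_if_contact_coeff_zero[OF Fil_diff[OF assms(1,2)]])
    (simp only: contact_coeff_diff assms(3) diff_self)

text \<open>
  The contact coefficients of the image only depend on those of the argument, and these do not change
  within a class.
\<close>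

lemma euler_gr1_class:
  assumes \<omega>: "\<omega> \<in> Fil W \<rho> s 1" and s: "s \<ge> 1"
  shows "euler_gr1 W \<rho> s (gr1_class W \<rho> s \<omega>) = gr1_class W \<rho> s (interior_euler W s \<omega>)"
proof -
  have "gr1_class W \<rho> s (interior_euler W s (h + \<omega>)) = gr1_class W \<rho> s (interior_euler W s \<omega>)"
    if h: "h \<in> Fil W \<rho> s 0" for h
  proof (rule gr1_class_eqI[OF Fil_0_diffI])
    have h\<omega>: "h + \<omega> \<in> Fil W \<rho> s 1" by (rule Fil_add[OF Fil_mono[OF h] \<omega>]) simp
    show "interior_euler W s (h + \<omega>) \<in> Fil W \<rho> s 1" "interior_euler W s \<omega> \<in> Fil W \<rho> s 1"
      by (rule interior_euler_Fil[OF h\<omega> s], rule interior_euler_Fil[OF \<omega> s])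
    have c: "contact_coeff \<rho> s (h + \<omega>) = contact_coeff \<rho> s \<omega>"
      by (intro ext) (simp only: contact_coeff_add contact_coeff_Fil_0[OF h] add_0)
    fix i z and \<alpha>s :: "'m list"
    assume \<alpha>s: "length \<alpha>s = s" and z: "z \<in> jets W"
    have "real s * contact_coeff \<rho> s (interior_euler W s (h + \<omega>)) i \<alpha>s z =
        real s * contact_coeff \<rho> s (interior_euler W s \<omega>) i \<alpha>s z"
      unfolding contact_coeff_interior_euler[OF h\<omega> s z \<alpha>s] contact_coeff_interior_euler[OF \<omega> s z \<alpha>s] c ..
    then show "contact_coeff \<rho> s (interior_euler W s (h + \<omega>)) i \<alpha>s z =
        contact_coeff \<rho> s (interior_euler W s \<omega>) i \<alpha>s z"
      using s by simp
  qed
  moreover have "Fil W \<rho> s 0 \<noteq> {}" using Fil_zero by blast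
  ultimately show ?thesis
    unfolding euler_gr1_def gr1_class_eq[of s \<omega>] by auto
qed

end

theorem proposition5p2:
  fixes W :: "('n::{finite,linorder}, 'm::finite) chart"
    and \<rho> :: "(real, 'n) vec \<Rightarrow> real"
    and s :: nat
  assumes "open W"
    and "volume_density W \<rho>"
    and "s \<ge> 1"
  shows "euler_gr1 W \<rho> s ` carrier (Gr1 W \<rho> s) =
      {gr1_class W \<rho> s (eta \<rho> s A) | A. admissible W s A \<and>
        (\<forall>i \<alpha>s. length \<alpha>s = s \<longrightarrow> (\<forall>z\<in>jets W. cyclic_sum s A i \<alpha>s z = 0))}
    \<and> kernel (Gr1 W \<rho> s) (Gr1 W \<rho> s) (euler_gr1 W \<rho> s) =
      {gr1_class W \<rho> s (eta \<rho> s A) | A. admissible W s A \<and>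
        (\<forall>i \<alpha>s. length \<alpha>s = s \<longrightarrow>
          (\<forall>z\<in>jets W. real s * A i \<alpha>s z = cyclic_sum s A i \<alpha>s z))}"
    (is "?image = ?I \<and> ?kernel = ?K")
proof -
  interpret adapted_chart W \<rho> by (rule adapted_chart.intro) (rule assms)+
  let ?e = "contact_coeff \<rho> s"
  let ?E = "interior_euler W s"
  note s = assms(3)
  note euler_value = contact_coeff_interior_euler[OF _ s]
  have normal: "gr1_class W \<rho> s \<omega> = gr1_class W \<rho> s (eta \<rho> s (?e \<omega>))" if "\<omega> \<in> Fil W \<rho> s 1" for \<omega>
    by (rule gr1_class_eqI[OF eta_contact_coeff[OF that]])
  have eta_value: "real s * ?e (?E (eta \<rho> s A)) i \<alpha>s z = real s * A i \<alpha>s z - cyclic_sum s A i \<alpha>s z"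
    if A: "admissible W s A" and \<alpha>s: "length \<alpha>s = s" and z: "z \<in> jets W" for A i \<alpha>s z
  proof -
    have "cyclic_sum s (?e (eta \<rho> s A)) i \<alpha>s z = cyclic_sum s A i \<alpha>s z"
      by (rule cyclic_sum_cong[OF _ \<alpha>s]) (rule contact_coeff_eta[OF A s _ z])
    then show ?thesis
      unfolding euler_value[OF eta_Fil[OF A s] z \<alpha>s] contact_coeff_eta[OF A s \<alpha>s z] by simp
  qed
  have "?image = ?I"
  proof
    show "?image \<subseteq> ?I"
    proof
      fix C assume "C \<in> ?image"
      then obtain \<omega> where \<omega>: "\<omega> \<in> Fil W \<rho> s 1" "C = gr1_class W \<rho> s (?E \<omega>)"
        unfolding carrier_Gr1 using euler_gr1_class[OF _ s] by blast
      note E\<omega> = interior_euler_Fil[OF \<omega>(1) s]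
      have "cyclic_sum s (?e (?E \<omega>)) i \<alpha>s z = 0" if \<alpha>s: "length \<alpha>s = s" and z: "z \<in> jets W" for i \<alpha>s z
      proof -
        have "real s * cyclic_sum s (?e (?E \<omega>)) i \<alpha>s z =
            (\<Sum>l<s. (-1) ^ ((s - 1) * l) * (real s * ?e (?E \<omega>) i (rotate l \<alpha>s) z))"
          by (simp add: cyclic_sum_def sum_distrib_left mult_ac)
        also have "\<dots> = (\<Sum>l<s. (-1) ^ ((s - 1) * l) *
            (real s * ?e \<omega> i (rotate l \<alpha>s) z - cyclic_sum s (?e \<omega>) i (rotate l \<alpha>s) z))"
          by (intro sum.cong refl) (simp only: euler_value[OF \<omega>(1) z] length_rotate \<alpha>s)
        also have "\<dots> = real s * cyclic_sum s (?e \<omega>) i \<alpha>s z - cyclic_sum s (cyclic_sum s (?e \<omega>)) i \<alpha>s z"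
          by (simp add: cyclic_sum_def[of s "?e \<omega>" i \<alpha>s] cyclic_sum_def[of s "cyclic_sum s (?e \<omega>)"]
              right_diff_distrib sum_subtractf sum_distrib_left mult_ac)
        also have "\<dots> = 0"
          using cyclic_sum_idempotent[OF \<alpha>s s, of "?e \<omega>" i z] by simp
        finally show ?thesis using s by simp
      qed
      then show "C \<in> ?I"
        using normal[OF E\<omega>] contact_coeff_admissible[OF E\<omega>] \<omega>(2) by blast
    qed
    show "?I \<subseteq> ?image"
    proof
      fix C assume "C \<in> ?I"
      then obtain A where A: "admissible W s A" "C = gr1_class W \<rho> s (eta \<rho> s A)"
        "\<And>i \<alpha>s z. length \<alpha>s = s \<Longrightarrow> z \<in> jets W \<Longrightarrow> cyclic_sum s A i \<alpha>s z = 0"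
        by blast
      note \<eta> = eta_Fil[OF A(1) s]
      have "?E (eta \<rho> s A) - eta \<rho> s A \<in> Fil W \<rho> s 0"
      proof (rule Fil_0_diffI[OF interior_euler_Fil[OF \<eta> s] \<eta>])
        fix i z and \<alpha>s :: "'m list"
        assume *: "length \<alpha>s = s" "z \<in> jets W"
        show "?e (?E (eta \<rho> s A)) i \<alpha>s z = ?e (eta \<rho> s A) i \<alpha>s z"
          using eta_value[OF A(1) *, of i] A(3)[OF *, of i] contact_coeff_eta[OF A(1) s *, of i] s
          by simp
      qed
      then have "C = euler_gr1 W \<rho> s (gr1_class W \<rho> s (eta \<rho> s A))"
        using gr1_class_eqI A(2) euler_gr1_class[OF \<eta> s] by simp
      then show "C \<in> ?image"
        unfolding carrier_Gr1 using \<eta> by blast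
    qed
  qed
  moreover have "?kernel = ?K"
  proof
    have k: "?kernel = {C \<in> gr1_class W \<rho> s ` Fil W \<rho> s 1. euler_gr1 W \<rho> s C = Fil W \<rho> s 0}"
      by (simp add: kernel_def carrier_Gr1 one_Gr1)
    show "?kernel \<subseteq> ?K"
    proof
      fix C assume "C \<in> ?kernel"
      then obtain \<omega> where \<omega>: "\<omega> \<in> Fil W \<rho> s 1" "C = gr1_class W \<rho> s \<omega>"
        "euler_gr1 W \<rho> s C = Fil W \<rho> s 0"
        unfolding k by blast
      then have 0: "?E \<omega> \<in> Fil W \<rho> s 0"
        using euler_gr1_class[OF \<omega>(1) s] gr1_class_eq_Fil_0_iff by simp
      have "real s * ?e \<omega> i \<alpha>s z = cyclic_sum s (?e \<omega>) i \<alpha>s z"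
        if "length \<alpha>s = s" "z \<in> jets W" for i \<alpha>s z
        using euler_value[OF \<omega>(1) that(2,1), of i] contact_coeff_Fil_0[OF 0, of i \<alpha>s z] by simp
      then show "C \<in> ?K"
        using normal[OF \<omega>(1)] contact_coeff_admissible[OF \<omega>(1)] \<omega>(2) by blast
    qed
    show "?K \<subseteq> ?kernel"
    proof
      fix C assume "C \<in> ?K"
      then obtain A where A: "admissible W s A" "C = gr1_class W \<rho> s (eta \<rho> s A)"
        "\<And>i \<alpha>s z. length \<alpha>s = s \<Longrightarrow> z \<in> jets W \<Longrightarrow> real s * A i \<alpha>s z = cyclic_sum s A i \<alpha>s z"
        by blast
      note \<eta> = eta_Fil[OF A(1) s]
      have "?E (eta \<rho> s A) \<in> Fil W \<rho> s 0"
      proof (rule Fil_0_if_contact_coeff_zero[OF interior_euler_Fil[OF \<eta> s]])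
        fix i z and \<alpha>s :: "'m list"
        assume *: "length \<alpha>s = s" "z \<in> jets W"
        show "?e (?E (eta \<rho> s A)) i \<alpha>s z = 0"
          using eta_value[OF A(1) *, of i] A(3)[OF *, of i] s by simp
      qed
      then have "euler_gr1 W \<rho> s C = Fil W \<rho> s 0"
        using euler_gr1_class[OF \<eta> s] gr1_class_eq_Fil_0_iff A(2) by simp
      then show "C \<in> ?kernel"
        unfolding k using \<eta> A(2) by blast
    qed
  qed
  ultimately show ?thesis by blast
qed

end
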